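(* Let $X$ be a compact metric space and $T: X \to X$ a continuous map which is not uniquely ergodic and whose set of periodic measures is dense in the set $\mathcal{M}_T$ of $T$-invariant Borel probability measures. Let $d \geq 1$. Then there exists a residual subset $\mathcal{R}$ of $C(X,\mathbb{R}^{d})$ such that for all $F \in \mathcal{R}$ the rotation set $R(F)$ is strictly convex and has $C^{1}$ boundary.
   Context: $\mathcal{M}_T$ denotes the set of $T$-invariant Borel probability measures on $X$, with the weak-$\star$ topology; $T$ is uniquely ergodic if $\mathcal{M}_T$ has exactly one element. For a periodic point $x$ of $T$, $\mu_{\mathcal{O}(x)}$ is the unique $T$-invariant probability measure supported on the (finite) orbit $\mathcal{O}(x)=\{T^j(x): j\ge 0\}$; such measures are called periodic measures, and their density in $\mathcal{M}_T$ is with respect to the weak-$\star$ topology. For $F \in C(X,\mathbb{R}^d)$ (continuous functions $X\to\mathbb{R}^d$), the rotation set is $R(F) = \left\{ \int F \, d\mu : \mu \in \mathcal{M}_T \right\}\subset \mathbb{R}^d$, which is non-empty, compact and convex. $C(X,\mathbb{R}^d)$ carries the uniform norm $\|F\|_\infty = \sup_{x\in X}\|F(x)\|$. A subset of a complete metric space is residual if it contains a countable intersection of open dense sets. A non-empty compact convex set $K\subset\mathbb{R}^d$ is strictly convex if its boundary contains no non-degenerate line segment. It has $C^1$ boundary if it has non-empty interior and $\partial K$ is a $C^1$ hypersurface; equivalently, it has non-empty interior and exactly one supporting hyperplane at each boundary point. *)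

theory Defs
  imports "HOL-Probability.Probability"
begin

definition invariant_measures :: "('a::topological_space \<Rightarrow> 'a) \<Rightarrow> 'a measure set" where
  "invariant_measures T =
     {\<mu>. prob_space \<mu> \<and> sets \<mu> = sets borel \<and> distr \<mu> borel T = \<mu>}"

definition uniquely_ergodic :: "('a::topological_space \<Rightarrow> 'a) \<Rightarrow> bool" where
  "uniquely_ergodic T \<longleftrightarrow> (\<exists>!\<mu>. \<mu> \<in> invariant_measures T)"

text \<open>The weak-star topology on the invariant measures is the coarsest one making every
  \<open>\<mu> \<mapsto> \<integral>x. f x \<partial>\<mu>\<close> with bounded continuous \<open>f\<close> continuous: the pullback of the product
  topology on the function type. On a compact space all continuous functions are bounded.\<close>

definition weak_star_topology :: "('a::topological_space \<Rightarrow> 'a) \<Rightarrow> 'a measure topology" where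
  "weak_star_topology T =
     pullback_topology (invariant_measures T)
       (\<lambda>\<mu> (f :: 'a \<Rightarrow>\<^sub>C real). \<integral>x. apply_bcontfun f x \<partial>\<mu>) euclidean"

definition periodic_point :: "('a \<Rightarrow> 'a) \<Rightarrow> 'a \<Rightarrow> bool" where
  "periodic_point T x \<longleftrightarrow> (\<exists>p>0. (T ^^ p) x = x)"

definition forward_orbit :: "('a \<Rightarrow> 'a) \<Rightarrow> 'a \<Rightarrow> 'a set" where
  "forward_orbit T x = range (\<lambda>j. (T ^^ j) x)"

definition periodic_measures :: "('a::topological_space \<Rightarrow> 'a) \<Rightarrow> 'a measure set" where
  "periodic_measures T =
     {\<mu> \<in> invariant_measures T. \<exists>x. periodic_point T x \<and> emeasure \<mu> (forward_orbit T x) = 1}"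

definition rotation_set ::
    "('a::topological_space \<Rightarrow> 'a) \<Rightarrow> ('a \<Rightarrow>\<^sub>C (real ^ 'n)) \<Rightarrow> (real ^ 'n) set" where
  "rotation_set T F = (\<lambda>\<mu>. \<integral>x. apply_bcontfun F x \<partial>\<mu>) ` invariant_measures T"

definition residual :: "'b::topological_space set \<Rightarrow> bool" where
  "residual S \<longleftrightarrow>
     (\<exists>\<G>. countable \<G> \<and> (\<forall>U\<in>\<G>. open U \<and> closure U = UNIV) \<and> \<Inter>\<G> \<subseteq> S)"

definition strictly_convex :: "'b::euclidean_space set \<Rightarrow> bool" where
  "strictly_convex K \<longleftrightarrow>
     K \<noteq> {} \<and> compact K \<and> convex K \<and>
     (\<forall>a b. a \<noteq> b \<longrightarrow> \<not> closed_segment a b \<subseteq> frontier K)"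

text \<open>A \<open>C\<^sup>1\<close> hypersurface is locally the zero set of a \<open>C\<^sup>1\<close> function with
  nowhere vanishing gradient.\<close>

definition C1_hypersurface :: "'b::euclidean_space set \<Rightarrow> bool" where
  "C1_hypersurface S \<longleftrightarrow>
     (\<forall>p\<in>S. \<exists>U (g :: 'b \<Rightarrow> real) g'.
        open U \<and> p \<in> U \<and>
        (\<forall>x\<in>U. GDERIV g x :> g' x) \<and>
        continuous_on U g' \<and> (\<forall>x\<in>U. g' x \<noteq> 0) \<and>
        S \<inter> U = {x\<in>U. g x = 0})"

definition C1_boundary :: "'b::euclidean_space set \<Rightarrow> bool" where
  "C1_boundary K \<longleftrightarrow> interior K \<noteq> {} \<and> C1_hypersurface (frontier K)"

end

theory Submission
  imports Defs
begin

text \<open>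
  Call a convex body \<open>\<epsilon>\<close>-regular if boundary points sharing an outer normal are \<open>\<epsilon>\<close>-close and
  unit outer normals at a common point are \<open>\<epsilon>\<close>-close. A body that is \<open>\<epsilon>\<close>-regular for all
  \<open>\<epsilon>\<close> is strictly convex with \<open>C\<^sup>1\<close> boundary, and \<open>\<epsilon>\<close>-regularity is open in the Hausdorff
  distance, so \<open>\<epsilon>\<close>-regularity of the rotation set is an open condition on \<open>F\<close>. It is also dense:
  take a strictly convex smooth body \<open>K\<close> slightly larger than \<open>R(F)\<close>. For large \<open>n\<close> the
  Birkhoff average \<open>A\<^sub>n F\<close> takes values in \<open>K\<close>, and it has the same integrals as \<open>F\<close>. For a finite net
  \<open>p\<^sub>i\<close> of \<open>K\<close> there are distinct periodic measures \<open>\<mu>\<^sub>i\<close> with \<open>\<integral>F d\<mu>\<^sub>i\<close> close to \<open>p\<^sub>i\<close>; on their orbits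
  \<open>A\<^sub>n F\<close> is constant when \<open>n\<close> is a common multiple of the periods. Moving \<open>A\<^sub>n F\<close> to \<open>p\<^sub>i\<close> on
  these orbits and retracting to \<open>K\<close> is a small perturbation whose rotation set lies in \<open>K\<close> and contains
  the net, hence is Hausdorff close to \<open>K\<close>.
\<close>

section \<open>Weak compactness of probability measures on a compact metric space\<close>

text \<open>At the first index \<open>m\<close> where the digits differ, the corresponding term has
  size \<open>(1/3)^m\<close>, and the remaining tail is at most half of that; moreover
  \<open>m\<close> is at most \<open>k\<close>. In base 2 the tail could cancel the leading term
  completely.\<close>

lemma ternary_digits_separate:
  fixes a b :: "nat \<Rightarrow> real"
  assumes a: "\<And>k. a k \<in> {0, 1}" and b: "\<And>k. b k \<in> {0, 1}" and ne: "a k \<noteq> b k"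
  shows "\<bar>(\<Sum>k. a k * (1/3)^k) - (\<Sum>k. b k * (1/3)^k)\<bar> \<ge> (1/3)^k / 2"
proof -
  define c where "c j = a j - b j" for j
  have c1: "\<bar>c j\<bar> \<le> 1" for j using a[of j] b[of j] by (auto simp: c_def)
  have a1: "\<bar>a j\<bar> \<le> 1" and b1: "\<bar>b j\<bar> \<le> 1" for j using a[of j] b[of j] by auto
  define m where "m = (LEAST j. c j \<noteq> 0)"
  have ck: "c k \<noteq> 0" using ne by (simp add: c_def)
  have mk: "m \<le> k" unfolding m_def using ck by (rule Least_le)
  have cm: "c m \<noteq> 0" unfolding m_def using ck by (rule LeastI)
  have cl: "c j = 0" if "j < m" for j using not_less_Least that unfolding m_def by blast
  have cm1: "\<bar>c m\<bar> = 1" using cm a[of m] b[of m] by (auto simp: c_def)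
  have g: "summable (\<lambda>k. (1/3::real)^k)" by (rule summable_geometric) simp
  have sd: "summable (\<lambda>k. d k * (1/3::real)^k)" if "\<And>k. \<bar>d k\<bar> \<le> 1" for d :: "nat \<Rightarrow> real"
    by (rule summable_comparison_test'[OF g, of 0])
       (use that in \<open>simp add: abs_mult mult_left_le_one_le\<close>)
  have "(\<Sum>k. a k * (1/3)^k) - (\<Sum>k. b k * (1/3)^k) = (\<Sum>k. a k * (1/3)^k - b k * (1/3)^k)"
    using a1 b1 by (intro suminf_diff sd)
  also have "\<dots> = (\<Sum>k. c k * (1/3)^k)" by (simp add: c_def left_diff_distrib)
  also have "\<dots> = (\<Sum>k. c (k + Suc m) * (1/3)^(k + Suc m)) + (\<Sum>j<Suc m. c j * (1/3)^j)"
    by (rule suminf_split_initial_segment) (rule sd[OF c1])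
  also have "(\<Sum>j<Suc m. c j * (1/3)^j) = c m * (1/3)^m" using cl by simp
  finally have eq: "(\<Sum>k. a k * (1/3)^k) - (\<Sum>k. b k * (1/3)^k)
     = (\<Sum>k. c (k + Suc m) * (1/3)^(k + Suc m)) + c m * (1/3)^m" .
  have gs: "summable (\<lambda>k. (1/3::real)^(k + Suc m))" using g by (subst summable_iff_shift)
  have "\<bar>\<Sum>k. c (k + Suc m) * (1/3)^(k + Suc m)\<bar> \<le> (\<Sum>k. (1/3)^(k + Suc m))"
    using norm_suminf_le[OF _ gs, of "\<lambda>k. c (k + Suc m) * (1/3)^(k + Suc m)"] c1
    by (simp add: abs_mult mult_left_le_one_le del: power_Suc add_Suc_right)
  also have "(\<Sum>k. (1/3::real)^(k + Suc m)) = (1/3)^Suc m * (\<Sum>k. (1/3)^k)"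
    by (subst suminf_mult[OF g, symmetric]) (simp add: power_add mult_ac)
  also have "\<dots> = (1/3)^m / 2" by (simp add: suminf_geometric)
  finally have t: "\<bar>\<Sum>k. c (k + Suc m) * (1/3)^(k + Suc m)\<bar> \<le> (1/3)^m / 2" .
  have "\<bar>c m * (1/3)^m\<bar> = (1/3)^m" using cm1 by (simp add: abs_mult)
  moreover have "(1/3::real)^k \<le> (1/3)^m" using mk by (intro power_decreasing) auto
  ultimately show ?thesis unfolding eq using t by linarith
qed

text \<open>A point is coded by the ternary number whose digits record membership in a countable family
  of balls. The code is only Borel, but its inverse is uniformly continuous, which is what lets Helly's
  selection theorem on the reals transfer to the space.\<close>

lemma compact_metric_coding:
  assumes "compact (UNIV :: 'a set)"
  obtains \<phi> :: "'a::metric_space \<Rightarrow> real" where "\<phi> \<in> borel_measurable borel" "range \<phi> \<subseteq> {0..2}"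
    "\<And>\<epsilon>. \<epsilon> > 0 \<Longrightarrow> \<exists>\<delta>>0. \<forall>x y. \<bar>\<phi> x - \<phi> y\<bar> < \<delta> \<longrightarrow> dist x y < \<epsilon>"
proof -
  have "\<forall>n. \<exists>k. finite k \<and> (UNIV::'a set) \<subseteq> (\<Union>x\<in>k. ball x (1 / real (Suc n)))"
    using assms[unfolded compact_eq_totally_bounded] by simp
  then obtain P where P: "\<And>n. finite (P n)" "\<And>n. (UNIV::'a set) \<subseteq> (\<Union>x\<in>P n. ball x (1 / real (Suc n)))"
    by metis
  define \<G> where "\<G> = (\<Union>n. (\<lambda>x. ball x (1 / real (Suc n))) ` P n)"
  have "countable \<G>" unfolding \<G>_def using P(1) by (auto intro: countable_finite)
  moreover have "P 0 \<noteq> {}" using P(2)[of 0] by auto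
  then have ne: "\<G> \<noteq> {}" unfolding \<G>_def by blast
  ultimately have rng: "range (from_nat_into \<G>) = \<G>" by (simp add: range_from_nat_into)
  define E where "E = from_nat_into \<G>"
  have Eo: "open (E k)" for k using rng unfolding E_def \<G>_def by (metis (no_types, lifting) UN_E imageE open_ball rangeI)
  define d where "d k x = (indicator (E k) x :: real)" for k x
  define \<phi> where "\<phi> x = (\<Sum>k. d k x * (1/3)^k)" for x
  have d01: "d k x \<in> {0,1}" for k x by (auto simp: d_def indicator_def)
  have g: "summable (\<lambda>k. (1/3::real)^k)" by (rule summable_geometric) simp
  have sd: "summable (\<lambda>k. d k x * (1/3::real)^k)" for x
    by (rule summable_comparison_test'[OF g, of 0]) (auto simp: d_def indicator_def)
  show thesis
  proof
    show "\<phi> \<in> borel_measurable borel"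
      unfolding \<phi>_def d_def using Eo by (intro borel_measurable_suminf borel_measurable_times borel_measurable_indicator borel_measurable_const) auto
    show "range \<phi> \<subseteq> {0..2}"
    proof safe
      fix x
      have "\<phi> x \<le> (\<Sum>k. (1/3)^k)" unfolding \<phi>_def by (intro suminf_le sd g) (auto simp: d_def indicator_def)
      also have "\<dots> \<le> 2" by (simp add: suminf_geometric)
      finally show "\<phi> x \<in> {0..2}" unfolding \<phi>_def using suminf_nonneg[OF sd] by (auto simp: d_def)
    qed
    fix \<epsilon> :: real assume "\<epsilon> > 0"
    then obtain n where "1 / real (Suc n) < \<epsilon> / 2" by (metis nat_approx_posE half_gt_zero)
    then have n: "2 / real (Suc n) < \<epsilon>" by (simp add: field_simps)
    \<comment> \<open>As \<open>P n\<close> is finite, finitely many digits decide membership in all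
      balls of radius \<open>1 / Suc n\<close> around its points.\<close>
    have "\<exists>k. \<forall>x\<in>P n. \<exists>j\<le>k. E j = ball x (1 / real (Suc n))"
    proof -
      have "\<exists>j. E j = ball x (1 / real (Suc n))" if "x \<in> P n" for x
        using rng that unfolding E_def \<G>_def by (metis (no_types, lifting) UN_I UNIV_I imageE imageI)
      then obtain J where J: "\<And>x. x \<in> P n \<Longrightarrow> E (J x) = ball x (1 / real (Suc n))" by metis
      have "J x \<le> Max (J ` P n)" if "x \<in> P n" for x using that P(1) by simp
      with J show ?thesis by blast
    qed
    then obtain k where k: "\<And>x. x \<in> P n \<Longrightarrow> \<exists>j\<le>k. E j = ball x (1 / real (Suc n))" by blast
    show "\<exists>\<delta>>0. \<forall>x y. \<bar>\<phi> x - \<phi> y\<bar> < \<delta> \<longrightarrow> dist x y < \<epsilon>"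
    \<comment> \<open>By digit separation, codes closer than this agree in all digits up to
      \<open>k\<close>, so \<open>x\<close> and \<open>y\<close> lie in a common ball of the
      cover.\<close>
    proof (intro exI[of _ "(1/3)^k / 2"] conjI allI impI)
      fix x y assume *: "\<bar>\<phi> x - \<phi> y\<bar> < (1/3)^k / 2"
      have eq: "d j x = d j y" if "j \<le> k" for j
      proof (rule ccontr)
        assume "d j x \<noteq> d j y"
        from ternary_digits_separate[of "\<lambda>k. d k x" "\<lambda>k. d k y", OF d01 d01 this]
        have "\<bar>\<phi> x - \<phi> y\<bar> \<ge> (1/3)^j / 2" by (simp add: \<phi>_def)
        moreover have "(1/3::real)^k \<le> (1/3)^j" using that by (intro power_decreasing) auto
        ultimately show False using * by linarith
      qed
      obtain p where p: "p \<in> P n" "x \<in> ball p (1 / real (Suc n))" using P(2)[of n] by blast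
      obtain j where j: "j \<le> k" "E j = ball p (1 / real (Suc n))" using k[OF p(1)] by blast
      have "y \<in> E j" using eq[OF j(1)] p j by (auto simp: d_def indicator_def split: if_splits)
      then show "dist x y < \<epsilon>" using j p n dist_triangle3[of x y p] by (auto simp: dist_commute)
    qed simp
  qed
qed

text \<open>The range of a code need not be closed, and a weak limit of image measures is only known
  to live on its closure, so the inverse is extended there. Compactness supplies limits of the coded
  points; the modulus of continuity makes the extension continuous and exact on the range.\<close>

lemma compact_metric_coding_inverse:
  fixes \<phi> :: "'a::metric_space \<Rightarrow> real"
  assumes cX: "compact (UNIV :: 'a set)"
    and uc: "\<And>\<epsilon>. \<epsilon> > 0 \<Longrightarrow> \<exists>\<delta>>0. \<forall>x y. \<bar>\<phi> x - \<phi> y\<bar> < \<delta> \<longrightarrow> dist x y < \<epsilon>"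
  obtains \<pi> where "continuous_on (closure (range \<phi>)) \<pi>" "\<And>x. \<pi> (\<phi> x) = x"
proof -
  have "\<exists>s x. (\<lambda>n. \<phi> (s n)) \<longlonglongrightarrow> c \<and> s \<longlonglongrightarrow> x" if c: "c \<in> closure (range \<phi>)" for c
  proof -
    obtain s where s: "(\<lambda>n. \<phi> (s n)) \<longlonglongrightarrow> c"
    proof -
      obtain t where t: "\<And>n. t n \<in> range \<phi>" "t \<longlonglongrightarrow> c" using c unfolding closure_sequential by blast
      then have "\<forall>n. \<exists>x. t n = \<phi> x" by blast
      then obtain s where "\<And>n. t n = \<phi> (s n)" by metis
      then have "t = (\<lambda>n. \<phi> (s n))" by blast
      with t(2) show ?thesis using that by blast
    qed
    obtain l r where "strict_mono r" "(s \<circ> r) \<longlonglongrightarrow> l"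
      using cX unfolding compact_def by (metis UNIV_I)
    then show ?thesis using LIMSEQ_subseq_LIMSEQ[OF s] by (auto simp: o_def intro!: exI[of _ "s \<circ> r"])
  qed
  then obtain s \<pi> where s: "\<And>c. c \<in> closure (range \<phi>) \<Longrightarrow> (\<lambda>n. \<phi> (s c n)) \<longlonglongrightarrow> c"
    and \<pi>: "\<And>c. c \<in> closure (range \<phi>) \<Longrightarrow> s c \<longlonglongrightarrow> \<pi> c" by metis
  have close: "dist (\<pi> c) (\<pi> c') \<le> \<epsilon>"
    if "\<forall>x y. \<bar>\<phi> x - \<phi> y\<bar> < \<delta> \<longrightarrow> dist x y < \<epsilon>" "\<bar>c - c'\<bar> < \<delta>" "c \<in> closure (range \<phi>)" "c' \<in> closure (range \<phi>)" for c c' \<delta> \<epsilon>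
  proof -
    have "(\<lambda>n. \<bar>\<phi> (s c n) - \<phi> (s c' n)\<bar>) \<longlonglongrightarrow> \<bar>c - c'\<bar>"
      by (intro tendsto_intros s that)
    from order_tendstoD(2)[OF this that(2)]
    have "\<forall>\<^sub>F n in sequentially. dist (s c n) (s c' n) \<le> \<epsilon>"
      by (rule eventually_mono) (use that(1) in \<open>auto intro: less_imp_le\<close>)
    then show ?thesis
      by (intro tendsto_upperbound[OF tendsto_dist[OF \<pi>[OF that(3)] \<pi>[OF that(4)]]]) auto
  qed
  have close': "dist (\<pi> (\<phi> x)) x \<le> \<epsilon>" if "\<epsilon> > 0" for x \<epsilon>
  proof -
    have cl: "\<phi> x \<in> closure (range \<phi>)" using closure_subset[of "range \<phi>"] by auto
    obtain \<delta> where \<delta>: "\<delta> > 0" "\<forall>x y. \<bar>\<phi> x - \<phi> y\<bar> < \<delta> \<longrightarrow> dist x y < \<epsilon>" using uc[OF \<open>\<epsilon> > 0\<close>] by blast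
    have "(\<lambda>n. \<bar>\<phi> (s (\<phi> x) n) - \<phi> x\<bar>) \<longlonglongrightarrow> \<bar>\<phi> x - \<phi> x\<bar>"
      by (intro tendsto_intros s cl)
    from order_tendstoD(2)[OF this, of \<delta>]
    have "\<forall>\<^sub>F n in sequentially. dist (s (\<phi> x) n) x \<le> \<epsilon>"
      using \<delta> by (auto elim!: eventually_mono intro: less_imp_le)
    then show ?thesis
      by (rule tendsto_upperbound[OF tendsto_dist[OF \<pi>[OF cl] tendsto_const]]) simp
  qed
  show thesis
  proof
    show "\<pi> (\<phi> x) = x" for x
      using field_le_epsilon[of "dist (\<pi> (\<phi> x)) x" 0] close'[of _ x] by simp
    show "continuous_on (closure (range \<phi>)) \<pi>"
      unfolding continuous_on_iff
    proof (intro ballI allI impI)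
      fix c and e :: real assume c: "c \<in> closure (range \<phi>)" and "e > 0"
      then obtain \<delta> where \<delta>: "\<delta> > 0" "\<forall>x y. \<bar>\<phi> x - \<phi> y\<bar> < \<delta> \<longrightarrow> dist x y < e/2" using uc[of "e/2"] by auto
      then show "\<exists>d>0. \<forall>x'\<in>closure (range \<phi>). dist x' c < d \<longrightarrow> dist (\<pi> x') (\<pi> c) < e"
        using close[OF \<delta>(2)] c \<open>e > 0\<close> by (intro exI[of _ \<delta>]) (force simp: dist_real_def)
    qed
  qed
qed

text \<open>The measures are pushed to the reals by the code \<open>\<phi>\<close>, where tightness
  gives a weakly convergent subsequence, and the limit is pulled back by the continuous
  inverse.\<close>

theorem compact_metric_weak_compactness:
  fixes \<mu> :: "nat \<Rightarrow> 'a::metric_space measure"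
  assumes cX: "compact (UNIV :: 'a set)"
    and ps: "\<And>n. prob_space (\<mu> n)" and st: "\<And>n. sets (\<mu> n) = sets borel"
  obtains r M where "strict_mono r" "prob_space M" "sets M = sets borel"
    "\<And>f :: 'a \<Rightarrow> real. continuous_on UNIV f \<Longrightarrow>
       (\<lambda>n. integral\<^sup>L (\<mu> (r n)) f) \<longlonglongrightarrow> integral\<^sup>L M f"
proof -
  obtain \<phi> :: "'a \<Rightarrow> real" where \<phi>[measurable]: "\<phi> \<in> borel_measurable borel" and \<phi>2: "range \<phi> \<subseteq> {0..2}"
    and uc: "\<And>\<epsilon>. \<epsilon> > 0 \<Longrightarrow> \<exists>\<delta>>0. \<forall>x y. \<bar>\<phi> x - \<phi> y\<bar> < \<delta> \<longrightarrow> dist x y < \<epsilon>"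
    using compact_metric_coding[OF cX] by metis
  define C where "C = closure (range \<phi>)"
  obtain \<pi> where \<pi>: "continuous_on C \<pi>" "\<And>x. \<pi> (\<phi> x) = x"
    using compact_metric_coding_inverse[OF cX uc] unfolding C_def by metis
  have \<phi>m: "\<phi> \<in> borel_measurable (\<mu> n)" for n
    using \<phi> by (simp add: measurable_cong_sets[OF st refl])
  define \<nu> where "\<nu> n = distr (\<mu> n) borel \<phi>" for n
  have rd: "real_distribution (\<nu> n)" for n
    unfolding \<nu>_def by (intro prob_space.real_distribution_distr ps \<phi>m)
  have "tight \<nu>"
    unfolding tight_def
  proof (intro conjI allI impI rd)
    fix e :: real assume "e > 0"
    \<comment> \<open>Tightness is formulated with left-open intervals, so the left end must be
      below 0, a possible value of the code.\<close>
    have "measure (\<nu> n) {-1<..2} = 1" for n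
    proof -
      interpret prob_space "\<mu> n" by (rule ps)
      have "\<phi> -` {-1<..2} \<inter> space (\<mu> n) = space (\<mu> n)"
        using \<phi>2 by (force simp: image_subset_iff)
      then show ?thesis unfolding \<nu>_def using \<phi>m by (subst measure_distr) (auto simp: prob_space)
    qed
    then show "\<exists>a b. a < b \<and> (\<forall>n. measure (\<nu> n) {a<..b} > 1 - e)"
      using \<open>e > 0\<close> by (intro exI[of _ "-1"] exI[of _ 2]) auto
  qed
  from tight_imp_convergent_subsubsequence[OF this, of id]
  obtain r N where r: "strict_mono r" and N: "real_distribution N" and wc: "weak_conv_m (\<nu> \<circ> r) N"
    by (auto simp: strict_mono_def)
  interpret N: real_distribution N by (rule N)
  have conv: "(\<lambda>n. integral\<^sup>L (\<nu> (r n)) f) \<longlonglongrightarrow> integral\<^sup>L N f"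
    if "continuous_on UNIV f" "\<And>x. norm (f x) \<le> B" for f :: "real \<Rightarrow> real" and B
    using weak_conv_imp_integral_bdd_continuous_conv[of "\<nu> \<circ> r" N f B] that rd N wc
    by (simp add: continuous_on_eq_continuous_at)
  have int: "integral\<^sup>L (\<nu> n) f = (\<integral>x. f (\<phi> x) \<partial>\<mu> n)" if "continuous_on UNIV f" for f :: "real \<Rightarrow> real" and n
    unfolding \<nu>_def by (rule integral_distr[OF \<phi>m]) (rule borel_measurable_continuous_onI[OF that])
  have Cc: "closed C" and Cne: "C \<noteq> {}" and C\<phi>: "\<phi> x \<in> C" for x
    using closure_subset[of "range \<phi>"] by (auto simp: C_def)
  have AEC: "AE t in N. t \<in> C"
  proof -
    \<comment> \<open>A bounded continuous function vanishing exactly on \<open>C\<close>: its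
      integrals are 0 along the sequence, hence also for \<open>N\<close>, which forces
      \<open>N\<close> to be carried by \<open>C\<close>.\<close>
    define h where "h t = min 1 (infdist t C)" for t
    have h: "continuous_on UNIV h" unfolding h_def by (intro continuous_intros)
    have hb: "norm (h t) \<le> 1" for t by (auto simp: h_def infdist_nonneg)
    have "integral\<^sup>L (\<nu> n) h = 0" for n
      unfolding int[OF h] using C\<phi> by (simp add: h_def)
    then have "integral\<^sup>L N h = 0" using conv[OF h hb] by (simp add: LIMSEQ_const_iff)
    moreover have "integrable N h"
      by (rule N.integrable_const_bound[where B=1]) (use hb borel_measurable_continuous_onI[OF h] in \<open>auto\<close>)
    ultimately have "AE t in N. h t = 0"
      by (subst (asm) integral_nonneg_eq_0_iff_AE) (auto simp: h_def infdist_nonneg)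
    then show ?thesis
      by (rule AE_mp) (auto simp: h_def min_def in_closed_iff_infdist_zero[OF Cc Cne] split: if_splits)
  qed
  \<comment> \<open>Outside \<open>C\<close>, a null set for \<open>N\<close>, a fixed point serves
    as default value, which makes the map Borel on the whole line.\<close>
  define \<pi>' where "\<pi>' t = (if t \<in> C then \<pi> t else \<pi> (\<phi> undefined))" for t
  have [measurable]: "\<pi>' \<in> measurable borel borel"
    unfolding \<pi>'_def
    by (rule borel_measurable_continuous_on_if) (use Cc \<pi>(1) in \<open>auto\<close>)
  define M where "M = distr N borel \<pi>'"
  have lim: "(\<lambda>n. integral\<^sup>L (\<mu> (r n)) f) \<longlonglongrightarrow> integral\<^sup>L M f"
    if f: "continuous_on UNIV f" for f :: "'a \<Rightarrow> real"
  proof -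
    have "compact (range f)" using cX f by (rule compact_continuous_image[rotated])
    then obtain B where B: "\<And>x. norm (f x) \<le> B" using compact_imp_bounded bounded_iff by (metis rangeI)
    have "continuous_on C (f \<circ> \<pi>)" using \<pi>(1) f by (metis continuous_on_compose continuous_on_subset subset_UNIV)
    moreover have "cball (0::real) B \<noteq> {}" using order_trans[OF norm_ge_zero B] by auto
    \<comment> \<open>Weak convergence on the line needs bounded continuous test functions on all of
      it. The Dugundji extension of \<open>f \<circ> \<pi>\<close> provides one, bounded because its
      values stay in the convex ball.\<close>
    ultimately obtain h where h: "continuous_on UNIV h" "h ` UNIV \<subseteq> cball 0 B" "\<And>t. t \<in> C \<Longrightarrow> h t = f (\<pi> t)"
      using Dugundji[of "cball (0::real) B" UNIV C "f \<circ> \<pi>"] B Cc by (auto simp: image_subset_iff)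
    have "(\<lambda>n. integral\<^sup>L (\<nu> (r n)) h) \<longlonglongrightarrow> integral\<^sup>L N h"
      by (rule conv[OF h(1), of B]) (use h(2) in \<open>auto simp: image_subset_iff\<close>)
    moreover have "integral\<^sup>L (\<nu> n) h = integral\<^sup>L (\<mu> n) f" for n
      unfolding int[OF h(1)] by (intro Bochner_Integration.integral_cong) (use h(3) C\<phi> \<pi> in auto)
    moreover have "integral\<^sup>L N h = integral\<^sup>L M f"
    proof -
      have fm: "f \<in> borel_measurable borel" by (rule borel_measurable_continuous_onI[OF f])
      have "AE t in N. h t = f (\<pi>' t)" using AEC by (rule AE_mp) (auto simp: \<pi>'_def h)
      then have "integral\<^sup>L N h = (\<integral>t. f (\<pi>' t) \<partial>N)"
        using fm borel_measurable_continuous_onI[OF h(1)] by (intro integral_cong_AE) simp_all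
      also have "\<dots> = integral\<^sup>L M f" unfolding M_def using fm by (subst integral_distr) simp_all
      finally show ?thesis .
    qed
    ultimately show ?thesis by simp
  qed
  show thesis
  proof
    show "prob_space M" unfolding M_def by (rule N.prob_space_distr) simp
  qed (use r lim in \<open>auto simp: M_def\<close>)
qed

section \<open>Invariant measures and Birkhoff averages\<close>

lemma continuous_integrable_of_compact:
  fixes f :: "'a::metric_space \<Rightarrow> 'b::euclidean_space"
  assumes "compact (UNIV :: 'a set)" "prob_space \<mu>" "sets \<mu> = sets borel" "continuous_on UNIV f"
  shows "integrable \<mu> f"
proof -
  interpret prob_space \<mu> by fact
  have "compact (range f)" using assms by (intro compact_continuous_image) auto
  then obtain B where "\<And>x. norm (f x) \<le> B" using compact_imp_bounded bounded_iff by (metis rangeI)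
  moreover have "f \<in> borel_measurable \<mu>"
    using borel_measurable_continuous_onI[OF assms(4)] by (simp add: measurable_cong_sets[OF assms(3) refl])
  ultimately show ?thesis by (intro integrable_const_bound[where B=B]) auto
qed

lemma tendsto_integral_componentwise:
  fixes f :: "'a \<Rightarrow> 'b::euclidean_space"
  assumes "\<And>n. integrable (\<mu> n) f" "integrable M f"
    and "\<And>b. b \<in> Basis \<Longrightarrow> ((\<lambda>n. \<integral>x. f x \<bullet> b \<partial>\<mu> n) \<longlongrightarrow> (\<integral>x. f x \<bullet> b \<partial>M)) F"
  shows "((\<lambda>n. integral\<^sup>L (\<mu> n) f) \<longlongrightarrow> integral\<^sup>L M f) F"
proof -
  have "((\<lambda>n. \<Sum>b\<in>Basis. (integral\<^sup>L (\<mu> n) f \<bullet> b) *\<^sub>R b) \<longlongrightarrow> (\<Sum>b\<in>Basis. (integral\<^sup>L M f \<bullet> b) *\<^sub>R b)) F"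
  proof (intro tendsto_sum tendsto_scaleR tendsto_const)
    fix b :: 'b assume "b \<in> Basis"
    from assms(3)[OF this] show "((\<lambda>n. integral\<^sup>L (\<mu> n) f \<bullet> b) \<longlongrightarrow> integral\<^sup>L M f \<bullet> b) F"
      using assms(1,2) by simp
  qed
  then show ?thesis by (simp add: euclidean_representation)
qed

text \<open>Closed sets form an intersection-stable generator of the Borel sets, and the indicator
  of a closed set is the pointwise limit of the continuous functions \<open>h k\<close>, to which
  dominated convergence applies.\<close>

lemma measure_eqI_continuous_integrals:
  fixes \<mu> \<nu> :: "'a::metric_space measure"
  assumes p: "prob_space \<mu>" "prob_space \<nu>" and s: "sets \<mu> = sets borel" "sets \<nu> = sets borel"
    and eq: "\<And>f :: 'a \<Rightarrow> real. \<lbrakk>continuous_on UNIV f; \<And>x. f x \<in> {0..1}\<rbrakk> \<Longrightarrow> integral\<^sup>L \<mu> f = integral\<^sup>L \<nu> f"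
  shows "\<mu> = \<nu>"
proof (rule measure_eqI_generator_eq[of "Collect closed" UNIV _ _ "\<lambda>_. UNIV"])
  show "sets \<mu> = sigma_sets UNIV (Collect closed)" "sets \<nu> = sigma_sets UNIV (Collect closed)"
    using s by (simp_all add: borel_eq_closed)
  show "emeasure \<mu> UNIV \<noteq> \<infinity>"
    using prob_space.emeasure_space_1[OF p(1)] sets_eq_imp_space_eq[OF s(1)] by simp
  fix A :: "'a set" assume "A \<in> Collect closed"
  then have A: "closed A" by simp
  show "emeasure \<mu> A = emeasure \<nu> A"
  proof (cases "A = {}")
    case False
    define h where "h k x = max 0 (1 - real k * infdist x A)" for k x
    have hc: "continuous_on UNIV (h k)" for k unfolding h_def by (intro continuous_intros)
    have h01: "h k x \<in> {0..1}" for k x by (auto simp: h_def infdist_nonneg)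
    have lim: "(\<lambda>k. h k x) \<longlonglongrightarrow> indicator A x" for x
    proof (cases "x \<in> A")
      case False
      then have "infdist x A > 0"
        using A \<open>A \<noteq> {}\<close> by (metis in_closed_iff_infdist_zero infdist_nonneg order_less_le)
      then obtain N where N: "real N * infdist x A > 1" using reals_Archimedean3 by blast
      have "h k x = 0" if "k \<ge> N" for k
      proof -
        have "real N * infdist x A \<le> real k * infdist x A"
          using that by (intro mult_right_mono) (auto simp: infdist_nonneg)
        with N show ?thesis by (simp add: h_def)
      qed
      then show ?thesis using False by (intro tendsto_eventually) (auto simp: eventually_sequentially)
    qed (simp add: h_def)
    have mlim: "(\<lambda>k. integral\<^sup>L M (h k)) \<longlonglongrightarrow> measure M A"
      if M: "prob_space M" "sets M = sets borel" for M :: "'a measure"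
    proof -
      interpret prob_space M by fact
      have [measurable]: "h k \<in> borel_measurable M" for k
        using borel_measurable_continuous_onI[OF hc] by (simp add: measurable_cong_sets[OF M(2) refl])
      have [measurable]: "A \<in> sets M" using A M(2) by simp
      have "(\<lambda>k. integral\<^sup>L M (h k)) \<longlonglongrightarrow> integral\<^sup>L M (indicator A)"
        by (rule integral_dominated_convergence[where w="\<lambda>_. 1"])
           (use lim h01 in \<open>auto simp: abs_le_iff intro: order_trans[of _ 0]\<close>)
      then show ?thesis by simp
    qed
    have "measure \<mu> A = measure \<nu> A"
      using mlim[OF p(1) s(1)] mlim[OF p(2) s(2)] eq[OF hc h01] by (simp add: LIMSEQ_unique)
    then show ?thesis
      using p by (simp add: finite_measure.emeasure_eq_measure prob_space_def)
  qed simp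
qed (auto simp: Int_stable_def)

text \<open>The mixture is a two-stage experiment: a coin with bias \<open>u\<close> selects one of
  the two measures. The formula for nonnegative integrals gives the claim for nonnegative
  \<open>f\<close>; adding a bound \<open>B\<close> reduces the general case to it.\<close>

lemma prob_space_mixture:
  fixes \<mu> \<nu> :: "'a::metric_space measure"
  assumes cX: "compact (UNIV :: 'a set)"
    and p: "prob_space \<mu>" "prob_space \<nu>" and s: "sets \<mu> = sets borel" "sets \<nu> = sets borel"
    and u: "0 \<le> u" "u \<le> 1"
  obtains M where "prob_space M" "sets M = sets borel"
    "\<And>f :: 'a \<Rightarrow> real. continuous_on UNIV f \<Longrightarrow>
       integral\<^sup>L M f = (1 - u) * integral\<^sup>L \<mu> f + u * integral\<^sup>L \<nu> f"
proof -
  define N where "N b = (if b then \<nu> else \<mu>)" for b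
  define M where "M = measure_pmf (bernoulli_pmf u) \<bind> N"
  have Np: "prob_space (N b)" and Ns: "sets (N b) = sets borel" for b using p s by (auto simp: N_def)
  have Nm: "N \<in> measurable (measure_pmf (bernoulli_pmf u)) (subprob_algebra borel)"
    using Np Ns by (auto simp: space_subprob_algebra intro: prob_space_imp_subprob_space)
  have Mp: "prob_space M" unfolding M_def
    by (rule measure_pmf.prob_space_bind[OF _ Nm]) (use Np in auto)
  have Ms: "sets M = sets borel" unfolding M_def by (rule sets_bind[OF Ns]) simp
  have pos: "integral\<^sup>L M f = (1 - u) * integral\<^sup>L \<mu> f + u * integral\<^sup>L \<nu> f"
    if f: "continuous_on UNIV f" and f0: "\<And>x. f x \<ge> 0" for f :: "'a \<Rightarrow> real"
  proof -
    have fm: "f \<in> borel_measurable borel" by (rule borel_measurable_continuous_onI[OF f])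
    have nn: "(\<integral>\<^sup>+x. f x \<partial>L) = integral\<^sup>L L f" if "prob_space L" "sets L = sets borel" for L :: "'a measure"
      by (rule nn_integral_eq_integral) (use continuous_integrable_of_compact[OF cX that f] f0 in auto)
    have i0: "integral\<^sup>L L f \<ge> 0" for L :: "'a measure" using f0 by (simp add: integral_nonneg_AE)
    have "ennreal (integral\<^sup>L M f) = (\<integral>\<^sup>+x. f x \<partial>M)" using nn[OF Mp Ms] by simp
    also have "\<dots> = (\<integral>\<^sup>+b. \<integral>\<^sup>+x. f x \<partial>N b \<partial>measure_pmf (bernoulli_pmf u))"
      unfolding M_def by (rule nn_integral_bind[OF _ Nm]) (use fm in simp)
    also have "\<dots> = ennreal (integral\<^sup>L \<nu> f) * u + ennreal (integral\<^sup>L \<mu> f) * (1 - u)"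
      using u nn[OF p(1) s(1)] nn[OF p(2) s(2)] by (simp add: N_def)
    also have "\<dots> = ennreal ((1 - u) * integral\<^sup>L \<mu> f + u * integral\<^sup>L \<nu> f)"
      using u i0 by (simp add: mult.commute add.commute flip: ennreal_mult ennreal_plus)
    finally show ?thesis using i0 u by (subst (asm) ennreal_inj) auto
  qed
  show thesis
  proof (rule that[OF Mp Ms])
    fix f :: "'a \<Rightarrow> real" assume f: "continuous_on UNIV f"
    have "compact (range f)" using cX f by (intro compact_continuous_image) auto
    then obtain B where B: "\<And>x. norm (f x) \<le> B" using compact_imp_bounded bounded_iff by (metis rangeI)
    have "f x + B \<ge> 0" for x using B[of x] by (simp add: abs_le_iff)
    moreover have "continuous_on UNIV (\<lambda>x. f x + B)" by (intro continuous_intros f)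
    ultimately have "integral\<^sup>L M (\<lambda>x. f x + B) = (1 - u) * integral\<^sup>L \<mu> (\<lambda>x. f x + B) + u * integral\<^sup>L \<nu> (\<lambda>x. f x + B)"
      using pos by blast
    moreover have "integral\<^sup>L L (\<lambda>x. f x + B) = integral\<^sup>L L f + B" if "prob_space L" "sets L = sets borel" for L :: "'a measure"
    proof -
      interpret prob_space L by fact
      show ?thesis using continuous_integrable_of_compact[OF cX that f] by (simp add: prob_space)
    qed
    ultimately show "integral\<^sup>L M f = (1 - u) * integral\<^sup>L \<mu> f + u * integral\<^sup>L \<nu> f"
      using p s Mp Ms by (simp add: algebra_simps)
  qed
qed

section \<open>Birkhoff averages, invariance and empirical measures\<close>

definition birkhoff_average :: "('a \<Rightarrow> 'a) \<Rightarrow> nat \<Rightarrow> ('a \<Rightarrow> 'b::real_vector) \<Rightarrow> 'a \<Rightarrow> 'b" where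
  "birkhoff_average T n f x = (1 / real n) *\<^sub>R (\<Sum>j<n. f ((T ^^ j) x))"

lemma continuous_on_funpow:
  fixes T :: "'a::topological_space \<Rightarrow> 'a"
  assumes "continuous_on UNIV T"
  shows "continuous_on UNIV (T ^^ j)"
proof (induction j)
  case (Suc j)
  have "continuous_on UNIV (\<lambda>x. T ((T ^^ j) x))"
    by (rule continuous_on_compose2[OF assms Suc]) auto
  then show ?case by (simp add: o_def)
qed simp

lemma continuous_on_birkhoff_average:
  fixes f :: "'a::topological_space \<Rightarrow> 'b::real_normed_vector"
  assumes "continuous_on UNIV T" "continuous_on UNIV f"
  shows "continuous_on UNIV (birkhoff_average T n f)"
  unfolding birkhoff_average_def
  by (intro continuous_intros continuous_on_compose2[OF assms(2) continuous_on_funpow[OF assms(1)]]) auto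

locale compact_dynamics =
  fixes T :: "'a::metric_space \<Rightarrow> 'a"
  assumes compact_UNIV: "compact (UNIV :: 'a set)" and continuous_T: "continuous_on UNIV T"
begin

definition integrals :: "('a \<Rightarrow> 'b::euclidean_space) \<Rightarrow> 'b set" where
  "integrals f = (\<lambda>\<mu>. integral\<^sup>L \<mu> f) ` invariant_measures T"

lemma apply_Bcontfun:
  fixes f :: "'a \<Rightarrow> 'b::metric_space"
  assumes "continuous_on UNIV f"
  shows "apply_bcontfun (Bcontfun f) = f"
  using compact_continuous_image[OF assms compact_UNIV] assms
  by (intro Bcontfun_inverse) (auto simp: bcontfun_def compact_imp_bounded)

lemma invariantD:
  assumes "\<mu> \<in> invariant_measures T"
  shows "prob_space \<mu>" "sets \<mu> = sets borel" "distr \<mu> borel T = \<mu>"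
  using assms by (auto simp: invariant_measures_def)

lemma integrable_invariant:
  fixes f :: "'a \<Rightarrow> 'b::euclidean_space"
  shows "\<mu> \<in> invariant_measures T \<Longrightarrow> continuous_on UNIV f \<Longrightarrow> integrable \<mu> f"
  using continuous_integrable_of_compact[OF compact_UNIV] invariantD by blast

lemma continuous_compose_T:
  fixes f :: "'a \<Rightarrow> 'b::topological_space"
  shows "continuous_on UNIV f \<Longrightarrow> continuous_on UNIV (\<lambda>x. f (T x))"
  using continuous_on_compose2[OF _ continuous_T] by blast

lemma measurable_T: "\<mu> \<in> invariant_measures T \<Longrightarrow> T \<in> measurable \<mu> borel"
  using borel_measurable_continuous_onI[OF continuous_T] invariantD(2) measurable_cong_sets[OF _ refl] by blast

lemma integral_compose_T:
  fixes f :: "'a \<Rightarrow> 'b::euclidean_space"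
  assumes \<mu>: "\<mu> \<in> invariant_measures T" and f: "continuous_on UNIV f"
  shows "(\<integral>x. f (T x) \<partial>\<mu>) = integral\<^sup>L \<mu> f"
  using integral_distr[OF measurable_T[OF \<mu>] borel_measurable_continuous_onI[OF f]] invariantD(3)[OF \<mu>] by simp

text \<open>Reduces invariance to identities between integrals of continuous functions, which
  survive weak limits and mixtures.\<close>

lemma invariantI:
  assumes p: "prob_space \<mu>" and s: "sets \<mu> = sets borel"
    and eq: "\<And>f :: 'a \<Rightarrow> real. continuous_on UNIV f \<Longrightarrow> (\<integral>x. f (T x) \<partial>\<mu>) = integral\<^sup>L \<mu> f"
  shows "\<mu> \<in> invariant_measures T"
proof -
  have Tm: "T \<in> measurable \<mu> borel"
    using borel_measurable_continuous_onI[OF continuous_T] by (simp add: measurable_cong_sets[OF s refl])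
  have "distr \<mu> borel T = \<mu>"
  proof (rule measure_eqI_continuous_integrals)
    show "prob_space (distr \<mu> borel T)" by (rule prob_space.prob_space_distr[OF p Tm])
    fix f :: "'a \<Rightarrow> real" assume f: "continuous_on UNIV f"
    show "integral\<^sup>L (distr \<mu> borel T) f = integral\<^sup>L \<mu> f"
      using eq[OF f] integral_distr[OF Tm borel_measurable_continuous_onI[OF f]] by simp
  qed (use p s in auto)
  with p s show ?thesis by (simp add: invariant_measures_def)
qed

lemma integral_birkhoff_average:
  fixes f :: "'a \<Rightarrow> 'b::euclidean_space"
  assumes \<mu>: "\<mu> \<in> invariant_measures T" and f: "continuous_on UNIV f" and n: "n > 0"
  shows "integral\<^sup>L \<mu> (birkhoff_average T n f) = integral\<^sup>L \<mu> f"
proof -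
  have c: "continuous_on UNIV (\<lambda>x. f ((T ^^ j) x))" for j
    by (rule continuous_on_compose2[OF f continuous_on_funpow[OF continuous_T]]) auto
  have "(\<integral>x. f ((T ^^ j) x) \<partial>\<mu>) = integral\<^sup>L \<mu> f" for j
  proof (induction j)
    case (Suc j)
    then show ?case using integral_compose_T[OF \<mu> c[of j]] by (simp add: funpow_swap1)
  qed simp
  then show ?thesis
    unfolding birkhoff_average_def using n integrable_invariant[OF \<mu> c]
    by (simp add: Bochner_Integration.integral_sum scaleR_conv_of_real sum_constant_scaleR)
qed

text \<open>Push the uniform distribution on the times \<open>{..<n}\<close> forward along the orbit
  of \<open>x\<close>.\<close>

lemma empirical_measure:
  assumes n: "n > 0"
  obtains E where "prob_space E" "sets E = sets borel"
    "\<And>f :: 'a \<Rightarrow> real. continuous_on UNIV f \<Longrightarrow> integral\<^sup>L E f = birkhoff_average T n f x"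
proof
  define E where "E = distr (measure_pmf (pmf_of_set {..<n})) borel (\<lambda>j. (T ^^ j) x)"
  show "prob_space E" unfolding E_def by (rule measure_pmf.prob_space_distr) simp
  show "sets E = sets borel" by (simp add: E_def)
  fix f :: "'a \<Rightarrow> real" assume f: "continuous_on UNIV f"
  have "{..<n} \<noteq> {}" using n by auto
  then show "integral\<^sup>L E f = birkhoff_average T n f x"
    unfolding E_def birkhoff_average_def
    by (subst integral_distr) (use borel_measurable_continuous_onI[OF f] in \<open>auto simp: integral_pmf_of_set\<close>)
qed

lemma birkhoff_average_inner:
  "birkhoff_average T n f x \<bullet> b = birkhoff_average T n (\<lambda>x. f x \<bullet> b) x"
  by (simp add: birkhoff_average_def inner_sum_left)

text \<open>The Krylov-Bogolyubov argument: a weak limit of empirical measures is invariant because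
  the averages of \<open>f \<circ> T\<close> and \<open>f\<close> telescope to a difference of at
  most \<open>2 * B / n\<close>. The starting point may change with \<open>k\<close>, which later
  yields estimates uniform in the point.\<close>

lemma birkhoff_averages_accumulate:
  fixes x :: "nat \<Rightarrow> 'a" and n :: "nat \<Rightarrow> nat"
  assumes n0: "\<And>k. n k > 0" and n: "filterlim n at_top sequentially"
  obtains r \<mu> where "strict_mono r" "\<mu> \<in> invariant_measures T"
    "\<And>f :: 'a \<Rightarrow> 'b::euclidean_space. continuous_on UNIV f \<Longrightarrow>
      (\<lambda>k. birkhoff_average T (n (r k)) f (x (r k))) \<longlonglongrightarrow> integral\<^sup>L \<mu> f"
proof -
  have "\<forall>k. \<exists>E. prob_space E \<and> sets E = sets borel \<and>
      (\<forall>f :: 'a \<Rightarrow> real. continuous_on UNIV f \<longrightarrow> integral\<^sup>L E f = birkhoff_average T (n k) f (x k))"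
    using empirical_measure[OF n0] by metis
  then obtain E where Ep: "\<And>k. prob_space (E k)" and Es: "\<And>k. sets (E k) = sets borel"
    and Ef: "\<And>k (f :: 'a \<Rightarrow> real). continuous_on UNIV f \<Longrightarrow> integral\<^sup>L (E k) f = birkhoff_average T (n k) f (x k)"
    by metis
  obtain r M where r: "strict_mono r" and Mp: "prob_space M" and Ms: "sets M = sets borel"
    and lim: "\<And>f :: 'a \<Rightarrow> real. continuous_on UNIV f \<Longrightarrow> (\<lambda>k. integral\<^sup>L (E (r k)) f) \<longlonglongrightarrow> integral\<^sup>L M f"
    by (rule compact_metric_weak_compactness[OF compact_UNIV Ep Es], rule that) assumption+
  have M: "M \<in> invariant_measures T"
  proof (rule invariantI[OF Mp Ms])
    fix f :: "'a \<Rightarrow> real" assume f: "continuous_on UNIV f"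
    have fT: "continuous_on UNIV (\<lambda>x. f (T x))" by (rule continuous_compose_T[OF f])
    have "compact (range f)" using compact_UNIV f by (intro compact_continuous_image) auto
    then obtain B where B: "\<And>x. norm (f x) \<le> B" using compact_imp_bounded bounded_iff by (metis rangeI)
    have nr: "filterlim (\<lambda>k. real (n (r k))) at_top sequentially"
      by (intro filterlim_compose[OF filterlim_real_sequentially] filterlim_compose[OF n] filterlim_subseq r)
    have "(\<lambda>k. integral\<^sup>L (E (r k)) (\<lambda>x. f (T x)) - integral\<^sup>L (E (r k)) f) \<longlonglongrightarrow> 0"
    proof (rule Lim_null_comparison)
      show "(\<lambda>k. (2 * B) / real (n (r k))) \<longlonglongrightarrow> 0"
        by (rule tendsto_divide_0[OF tendsto_const]) (use nr filterlim_at_top_imp_at_infinity in blast)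
      have "norm (integral\<^sup>L (E k) (\<lambda>x. f (T x)) - integral\<^sup>L (E k) f) \<le> (2 * B) / real (n k)" for k
      proof -
        have "integral\<^sup>L (E k) (\<lambda>x. f (T x)) - integral\<^sup>L (E k) f
          = (1 / real (n k)) * (\<Sum>j<n k. f ((T ^^ Suc j) (x k)) - f ((T ^^ j) (x k)))"
          unfolding Ef[OF f] Ef[OF fT] birkhoff_average_def by (simp add: sum_subtractf right_diff_distrib)
        also have "(\<Sum>j<n k. f ((T ^^ Suc j) (x k)) - f ((T ^^ j) (x k))) = f ((T ^^ n k) (x k)) - f (x k)"
          by (subst sum_lessThan_telescope) simp
        finally have "norm (integral\<^sup>L (E k) (\<lambda>x. f (T x)) - integral\<^sup>L (E k) f)
          = \<bar>f ((T ^^ n k) (x k)) - f (x k)\<bar> / real (n k)" by (simp add: abs_mult)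
        also have "\<dots> \<le> (2 * B) / real (n k)"
          using B[of "(T ^^ n k) (x k)"] B[of "x k"] by (intro divide_right_mono) auto
        finally show ?thesis .
      qed
      then show "\<forall>\<^sub>F k in sequentially. norm (integral\<^sup>L (E (r k)) (\<lambda>x. f (T x)) - integral\<^sup>L (E (r k)) f) \<le> (2 * B) / real (n (r k))"
        by simp
    qed
    moreover have "(\<lambda>k. integral\<^sup>L (E (r k)) (\<lambda>x. f (T x)) - integral\<^sup>L (E (r k)) f) \<longlonglongrightarrow> (\<integral>x. f (T x) \<partial>M) - integral\<^sup>L M f"
      by (intro tendsto_diff lim f fT)
    ultimately show "(\<integral>x. f (T x) \<partial>M) = integral\<^sup>L M f" using LIMSEQ_unique by fastforce
  qed
  have "(\<lambda>k. birkhoff_average T (n (r k)) f (x (r k))) \<longlonglongrightarrow> integral\<^sup>L M f"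
    if f: "continuous_on UNIV f" for f :: "'a \<Rightarrow> 'b"
  proof -
    have c: "continuous_on UNIV (\<lambda>x. f x \<bullet> b)" for b by (intro continuous_intros f)
    have "birkhoff_average T (n k) f (x k) = integral\<^sup>L (E k) f" for k
      by (rule euclidean_eqI) (use Ef[OF c] continuous_integrable_of_compact[OF compact_UNIV Ep Es f] in
          \<open>simp add: birkhoff_average_inner flip: integral_inner_left\<close>)
    moreover have "(\<lambda>k. integral\<^sup>L (E (r k)) f) \<longlonglongrightarrow> integral\<^sup>L M f"
    proof (rule tendsto_integral_componentwise)
      show "(\<lambda>k. \<integral>x. f x \<bullet> b \<partial>E (r k)) \<longlonglongrightarrow> (\<integral>x. f x \<bullet> b \<partial>M)" for b by (rule lim[OF c])
    qed (rule continuous_integrable_of_compact[OF compact_UNIV Ep Es f]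
        continuous_integrable_of_compact[OF compact_UNIV Mp Ms f])+
    ultimately show ?thesis by simp
  qed
  then show thesis by (rule that[OF r M])
qed

lemma invariant_measures_nonempty: "invariant_measures T \<noteq> {}"
  by (rule birkhoff_averages_accumulate[of Suc, OF _ filterlim_Suc]) auto

text \<open>Otherwise there are arbitrarily long averages, at varying points, that stay
  \<open>\<delta>\<close>-far from all integrals; but a subsequence of them converges to the
  integral of \<open>f\<close> for some invariant measure.\<close>

lemma birkhoff_average_near_integrals:
  fixes f :: "'a \<Rightarrow> 'b::euclidean_space"
  assumes f: "continuous_on UNIV f" and \<delta>: "\<delta> > 0"
  obtains N where "\<And>n x. n \<ge> N \<Longrightarrow> \<exists>z\<in>integrals f. dist (birkhoff_average T n f x) z < \<delta>"
proof (rule ccontr)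
  assume "\<not> thesis"
  then have "\<forall>N. \<exists>n x. n \<ge> N \<and> (\<forall>z\<in>integrals f. dist (birkhoff_average T n f x) z \<ge> \<delta>)"
    using that by (metis linorder_not_less)
  \<comment> \<open>Passing to \<open>Suc N\<close> keeps all chosen lengths positive.\<close>
  then have "\<forall>N. \<exists>n x. n \<ge> Suc N \<and> (\<forall>z\<in>integrals f. dist (birkhoff_average T n f x) z \<ge> \<delta>)" by blast
  then obtain n x where n: "\<And>N. n N \<ge> Suc N"
    and far: "\<And>N z. z \<in> integrals f \<Longrightarrow> dist (birkhoff_average T (n N) f (x N)) z \<ge> \<delta>" by metis
  have n0: "n k > 0" for k using n[of k] by simp
  have "filterlim n at_top sequentially"
    by (rule filterlim_at_top_mono[OF filterlim_Suc]) (use n in simp)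
  note acc = birkhoff_averages_accumulate[OF n0 this]
  obtain r \<mu> where "strict_mono (r :: nat \<Rightarrow> nat)" and \<mu>: "\<mu> \<in> invariant_measures T"
    and lim: "\<And>f :: 'a \<Rightarrow> 'b. continuous_on UNIV f \<Longrightarrow>
      (\<lambda>k. birkhoff_average T (n (r k)) f (x (r k))) \<longlonglongrightarrow> integral\<^sup>L \<mu> f"
    by (rule acc, rule that) assumption+
  from lim[OF f] have "\<forall>\<^sub>F k in sequentially. dist (birkhoff_average T (n (r k)) f (x (r k))) (integral\<^sup>L \<mu> f) < \<delta>"
    using \<delta> tendstoD by blast
  then obtain k where "dist (birkhoff_average T (n (r k)) f (x (r k))) (integral\<^sup>L \<mu> f) < \<delta>"
    using eventually_happens'[OF sequentially_bot] by blast
  moreover have "integral\<^sup>L \<mu> f \<in> integrals f" using \<mu> by (auto simp: integrals_def)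
  ultimately show False using far by (metis linorder_not_less)
qed

section \<open>Convexity and compactness of the set of integrals\<close>

lemma invariant_mixture:
  assumes "\<mu> \<in> invariant_measures T" "\<nu> \<in> invariant_measures T" "0 \<le> u" "u \<le> 1"
  obtains M where "M \<in> invariant_measures T"
    "\<And>f :: 'a \<Rightarrow> 'b::euclidean_space. continuous_on UNIV f \<Longrightarrow>
       integral\<^sup>L M f = (1 - u) *\<^sub>R integral\<^sup>L \<mu> f + u *\<^sub>R integral\<^sup>L \<nu> f"
proof -
  note i = invariantD[OF assms(1)] invariantD[OF assms(2)]
  obtain M where Mp: "prob_space M" and Ms: "sets M = sets borel"
    and M: "\<And>f :: 'a \<Rightarrow> real. continuous_on UNIV f \<Longrightarrow>
       integral\<^sup>L M f = (1 - u) * integral\<^sup>L \<mu> f + u * integral\<^sup>L \<nu> f"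
    by (rule prob_space_mixture[OF compact_UNIV i(1) i(4) i(2) i(5) assms(3,4)], rule that) assumption+
  show thesis
  proof
    show "M \<in> invariant_measures T"
      by (rule invariantI[OF Mp Ms]) (simp add: M continuous_compose_T integral_compose_T assms)
    fix f :: "'a \<Rightarrow> 'b" assume f: "continuous_on UNIV f"
    have c: "continuous_on UNIV (\<lambda>x. f x \<bullet> b)" for b by (intro continuous_intros f)
    show "integral\<^sup>L M f = (1 - u) *\<^sub>R integral\<^sup>L \<mu> f + u *\<^sub>R integral\<^sup>L \<nu> f"
      by (rule euclidean_eqI)
         (use M[OF c] continuous_integrable_of_compact[OF compact_UNIV Mp Ms f] integrable_invariant[OF assms(1) f]
            integrable_invariant[OF assms(2) f] in \<open>simp add: inner_add_left\<close>)
  qed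
qed

lemma integrals_nonempty: "integrals f \<noteq> {}"
  using invariant_measures_nonempty by (simp add: integrals_def)

lemma convex_integrals:
  fixes f :: "'a \<Rightarrow> 'b::euclidean_space"
  assumes f: "continuous_on UNIV f"
  shows "convex (integrals f)"
  unfolding convex_alt
proof (intro ballI allI impI)
  fix x y u assume "x \<in> integrals f" "y \<in> integrals f" and u: "0 \<le> (u::real) \<and> u \<le> 1"
  then obtain \<mu> \<nu> where m: "\<mu> \<in> invariant_measures T" "\<nu> \<in> invariant_measures T"
    and xy: "x = integral\<^sup>L \<mu> f" "y = integral\<^sup>L \<nu> f"
    by (auto simp: integrals_def)
  obtain M where "M \<in> invariant_measures T" and M: "\<And>f :: 'a \<Rightarrow> 'b. continuous_on UNIV f \<Longrightarrow>
       integral\<^sup>L M f = (1 - u) *\<^sub>R integral\<^sup>L \<mu> f + u *\<^sub>R integral\<^sup>L \<nu> f"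
    by (rule invariant_mixture[OF m conjunct1[OF u] conjunct2[OF u]], rule that) assumption+
  with M[OF f, folded xy] show "(1 - u) *\<^sub>R x + u *\<^sub>R y \<in> integrals f" unfolding integrals_def by (metis imageI)
qed

text \<open>Realise a sequence of integrals by invariant measures and pass to a weak limit, which is
  again invariant.\<close>

lemma compact_integrals:
  fixes f :: "'a \<Rightarrow> 'b::euclidean_space"
  assumes f: "continuous_on UNIV f"
  shows "compact (integrals f)"
  unfolding compact_def
proof (intro allI impI)
  fix s :: "nat \<Rightarrow> 'b" assume "\<forall>n. s n \<in> integrals f"
  then have "\<forall>n. \<exists>\<mu>. \<mu> \<in> invariant_measures T \<and> s n = integral\<^sup>L \<mu> f" by (auto simp: integrals_def)
  then obtain \<mu> where \<mu>: "\<And>n. \<mu> n \<in> invariant_measures T" and s: "\<And>n. s n = integral\<^sup>L (\<mu> n) f" by metis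
  obtain r M where r: "strict_mono r" and Mp: "prob_space M" and Ms: "sets M = sets borel"
    and lim: "\<And>f :: 'a \<Rightarrow> real. continuous_on UNIV f \<Longrightarrow> (\<lambda>k. integral\<^sup>L (\<mu> (r k)) f) \<longlonglongrightarrow> integral\<^sup>L M f"
    by (rule compact_metric_weak_compactness[OF compact_UNIV invariantD(1)[OF \<mu>] invariantD(2)[OF \<mu>]], rule that)
       assumption+
  have "M \<in> invariant_measures T"
  proof (rule invariantI[OF Mp Ms])
    fix f :: "'a \<Rightarrow> real" assume f: "continuous_on UNIV f"
    have "(\<lambda>k. integral\<^sup>L (\<mu> (r k)) f) \<longlonglongrightarrow> (\<integral>x. f (T x) \<partial>M)"
      using lim[OF continuous_compose_T[OF f]] by (simp add: integral_compose_T \<mu> f)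
    then show "(\<integral>x. f (T x) \<partial>M) = integral\<^sup>L M f" using lim[OF f] LIMSEQ_unique by blast
  qed
  moreover have "(s \<circ> r) \<longlonglongrightarrow> integral\<^sup>L M f"
    unfolding o_def s
  proof (rule tendsto_integral_componentwise)
    show "(\<lambda>n. \<integral>x. f x \<bullet> b \<partial>\<mu> (r n)) \<longlonglongrightarrow> (\<integral>x. f x \<bullet> b \<partial>M)" for b
      by (rule lim) (intro continuous_intros f)
  qed (use \<mu> f integrable_invariant continuous_integrable_of_compact[OF compact_UNIV Mp Ms f] in auto)
  ultimately show "\<exists>l\<in>integrals f. \<exists>r. strict_mono r \<and> (s \<circ> r) \<longlonglongrightarrow> l"
    using r by (auto simp: integrals_def)
qed

end

section \<open>Perturbation along periodic orbits\<close>

text \<open>For the point \<open>q\<close> of \<open>K\<close> nearest to the mean \<open>z\<close>,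
  the inequality \<open>(z - q) \<bullet> (f x - q) \<le> 0\<close> holds at every \<open>x\<close>;
  integrating it gives \<open>(z - q) \<bullet> (z - q) \<le> 0\<close>.\<close>

lemma (in prob_space) integral_in_closed_convex:
  fixes f :: "'a \<Rightarrow> 'b::euclidean_space"
  assumes K: "closed K" "convex K" and f: "integrable M f" and fK: "\<And>x. f x \<in> K"
  shows "integral\<^sup>L M f \<in> K"
proof -
  define z q where "z = integral\<^sup>L M f" and "q = closest_point K z"
  have "K \<noteq> {}" using fK by auto
  have "(z - q) \<bullet> (z - q) = (\<integral>x. (z - q) \<bullet> (f x - q) \<partial>M)"
    using f by (simp add: z_def prob_space)
  also have "\<dots> \<le> (\<integral>x. 0 \<partial>M)"
    by (rule integral_mono) (use f closest_point_dot[OF K(2,1) fK] in \<open>auto simp: q_def\<close>)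
  finally have "(z - q) \<bullet> (z - q) \<le> 0" by simp
  then have "z = q" by (metis eq_iff_diff_eq_0 inner_ge_zero inner_eq_zero_iff order_antisym)
  then show ?thesis using closest_point_in_set[OF K(1) \<open>K \<noteq> {}\<close>] by (metis q_def z_def)
qed

lemma finite_forward_orbit:
  assumes "p > 0" "(T ^^ p) x = x"
  shows "finite (forward_orbit T x)"
proof -
  have "(T ^^ j) x \<in> (\<lambda>j. (T ^^ j) x) ` {..<p}" for j
    using assms funpow_mod_eq[where f=T and n=p and m=j and x=x] by (auto intro!: image_eqI[of _ _ "j mod p"])
  then have "forward_orbit T x \<subseteq> (\<lambda>j. (T ^^ j) x) ` {..<p}" by (auto simp: forward_orbit_def)
  then show ?thesis by (rule finite_subset) simp
qed

text \<open>Shifting the starting point by one step drops the first summand and appends the value at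
  time \<open>n\<close>, and periodicity makes the two equal.\<close>

lemma birkhoff_average_periodic:
  assumes "(T ^^ n) x = x"
  shows "birkhoff_average T n f ((T ^^ j) x) = birkhoff_average T n f x"
proof (induction j)
  case (Suc j)
  define y where "y = (T ^^ j) x"
  have y: "(T ^^ n) y = y"
    using assms by (metis y_def add.commute comp_apply funpow_add)
  have "(\<Sum>i<n. f ((T ^^ i) (T y))) + f y = (\<Sum>i<Suc n. f ((T ^^ i) y))"
    by (simp add: sum.lessThan_Suc_shift funpow_swap1 del: sum.lessThan_Suc)
  also have "\<dots> = (\<Sum>i<n. f ((T ^^ i) y)) + f y" by (simp add: y)
  finally show ?case using Suc by (simp add: birkhoff_average_def y_def)
qed simp

context compact_dynamics
begin

text \<open>Stated for two codomains because one period has to serve functions of both types.\<close>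

lemma periodic_measure_birkhoff:
  assumes "\<mu> \<in> periodic_measures T"
  obtains p where "p > 0"
    "\<And>n f. \<lbrakk>n > 0; p dvd n; continuous_on UNIV (f :: 'a \<Rightarrow> 'b::euclidean_space)\<rbrakk> \<Longrightarrow>
       AE y in \<mu>. birkhoff_average T n f y = integral\<^sup>L \<mu> f"
    "\<And>n f. \<lbrakk>n > 0; p dvd n; continuous_on UNIV (f :: 'a \<Rightarrow> 'c::euclidean_space)\<rbrakk> \<Longrightarrow>
       AE y in \<mu>. birkhoff_average T n f y = integral\<^sup>L \<mu> f"
proof -
  obtain x p where \<mu>: "\<mu> \<in> invariant_measures T" and p: "p > 0" "(T ^^ p) x = x"
    and O1: "emeasure \<mu> (forward_orbit T x) = 1"
    using assms by (auto simp: periodic_measures_def periodic_point_def)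
  interpret prob_space \<mu> using invariantD[OF \<mu>] by simp
  have "forward_orbit T x \<in> sets \<mu>"
    using finite_imp_closed[OF finite_forward_orbit[OF p]] invariantD[OF \<mu>] by auto
  then have AEO: "AE y in \<mu>. y \<in> forward_orbit T x"
    using O1 emeasure_eq_1_AE by (simp add: emeasure_eq_measure prob_eq_1)
  have const: "AE y in \<mu>. birkhoff_average T n f y = integral\<^sup>L \<mu> f"
    if n: "n > 0" "p dvd n" and f: "continuous_on UNIV f" for n and f :: "'a \<Rightarrow> 'd::euclidean_space"
  proof -
    have "(T ^^ n) x = x"
      using funpow_mod_eq[where f=T and n=p and m=n and x=x] p n by simp
    then have "birkhoff_average T n f y = birkhoff_average T n f x" if "y \<in> forward_orbit T x" for y
      using that birkhoff_average_periodic[of n T x f] by (auto simp: forward_orbit_def)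
    then have AE: "AE y in \<mu>. birkhoff_average T n f y = birkhoff_average T n f x"
      using AEO by (auto elim: AE_mp)
    have c: "continuous_on UNIV (birkhoff_average T n f)"
      by (rule continuous_on_birkhoff_average[OF continuous_T f])
    have "integral\<^sup>L \<mu> f = integral\<^sup>L \<mu> (birkhoff_average T n f)"
      using integral_birkhoff_average[OF \<mu> f n(1)] by simp
    also have "\<dots> = (\<integral>y. birkhoff_average T n f x \<partial>\<mu>)"
      by (rule integral_cong_AE) (use AE integrable_invariant[OF \<mu> c] in auto)
    also have "\<dots> = birkhoff_average T n f x" by (simp add: prob_space)
    finally show ?thesis using AE by simp
  qed
  show thesis by (rule that[OF p(1)]; rule const)
qed

end

section \<open>Approximation by periodic measures\<close>

locale dense_periodic_dynamics = compact_dynamics +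
  assumes dense: "weak_star_topology T closure_of periodic_measures T = invariant_measures T"
begin

text \<open>The finitely many components of \<open>f\<close> define a basic weak-star neighbourhood
  of \<open>\<mu>\<close>, which density makes meet the periodic measures. The tolerance
  \<open>\<epsilon> / DIM('b)\<close> per component adds up to \<open>\<epsilon>\<close> in the sum
  norm.\<close>

lemma periodic_measures_approximate:
  fixes f :: "'a \<Rightarrow> 'b::euclidean_space"
  assumes \<mu>: "\<mu> \<in> invariant_measures T" and f: "continuous_on UNIV f" and \<epsilon>: "\<epsilon> > 0"
  obtains \<nu> where "\<nu> \<in> periodic_measures T" "dist (integral\<^sup>L \<nu> f) (integral\<^sup>L \<mu> f) < \<epsilon>"
proof -
  define h where "h b = Bcontfun (\<lambda>x. f x \<bullet> b)" for b
  define \<delta> where "\<delta> = \<epsilon> / real DIM('b)"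
  have \<delta>: "\<delta> > 0" using \<epsilon> by (simp add: \<delta>_def)
  have h: "apply_bcontfun (h b) = (\<lambda>x. f x \<bullet> b)" for b
    unfolding h_def by (intro apply_Bcontfun continuous_intros f)
  define U where "U = {\<phi> :: ('a \<Rightarrow>\<^sub>C real) \<Rightarrow> real. \<forall>b\<in>Basis. \<phi> (h b) \<in> ball (\<integral>x. f x \<bullet> b \<partial>\<mu>) \<delta>}"
  have "open U" unfolding U_def by (rule product_topology_basis') auto
  define V where "V = (\<lambda>\<mu> h. \<integral>x. apply_bcontfun h x \<partial>\<mu>) -` U \<inter> invariant_measures T"
  have V: "openin (weak_star_topology T) V"
    unfolding weak_star_topology_def openin_pullback_topology V_def using \<open>open U\<close> by auto
  have "\<mu> \<in> V" using \<mu> \<delta> by (auto simp: V_def U_def h)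
  then obtain \<nu> where \<nu>: "\<nu> \<in> periodic_measures T" "\<nu> \<in> V"
    using \<mu> dense V unfolding in_closure_of set_eq_iff by blast
  have \<nu>i: "\<nu> \<in> invariant_measures T" using \<nu>(2) by (simp add: V_def)
  have "norm (integral\<^sup>L \<nu> f - integral\<^sup>L \<mu> f) \<le> (\<Sum>b\<in>Basis. \<bar>(integral\<^sup>L \<nu> f - integral\<^sup>L \<mu> f) \<bullet> b\<bar>)"
    by (rule norm_le_l1)
  also have "\<dots> < real DIM('b) * \<delta>"
  proof (rule sum_bounded_above_strict)
    fix b :: 'b assume "b \<in> Basis"
    then have "(\<integral>x. f x \<bullet> b \<partial>\<nu>) \<in> ball (\<integral>x. f x \<bullet> b \<partial>\<mu>) \<delta>" using \<nu>(2) by (auto simp: V_def U_def h)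
    then show "\<bar>(integral\<^sup>L \<nu> f - integral\<^sup>L \<mu> f) \<bullet> b\<bar> < \<delta>"
      using integrable_invariant[OF \<mu> f] integrable_invariant[OF \<nu>i f]
      by (simp add: inner_diff_left dist_real_def abs_minus_commute)
  qed simp
  also have "\<dots> = \<epsilon>" by (simp add: \<delta>_def)
  finally show thesis using that \<nu>(1) by (simp add: dist_norm)
qed

text \<open>Mixing \<open>\<mu>\<close> with a little of a measure having another integral of
  \<open>g\<close> moves the integral of \<open>g\<close> through infinitely many values, so some
  mixture avoids the finite set \<open>B\<close>. Avoiding \<open>B\<close> is an open condition,
  hence it persists when the pair of integrals of \<open>f\<close> and \<open>g\<close> is
  approximated by a periodic measure.\<close>

lemma periodic_measure_avoiding:
  fixes f :: "'a \<Rightarrow> 'b::euclidean_space" and g :: "'a \<Rightarrow> real"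
  assumes f: "continuous_on UNIV f" and g: "continuous_on UNIV g"
    and two: "\<mu>\<^sub>1 \<in> invariant_measures T" "\<mu>\<^sub>2 \<in> invariant_measures T" "integral\<^sup>L \<mu>\<^sub>1 g \<noteq> integral\<^sup>L \<mu>\<^sub>2 g"
    and \<mu>: "\<mu> \<in> invariant_measures T" and \<epsilon>: "\<epsilon> > 0" and B: "finite B"
  obtains \<nu> where "\<nu> \<in> periodic_measures T" "dist (integral\<^sup>L \<nu> f) (integral\<^sup>L \<mu> f) < \<epsilon>" "integral\<^sup>L \<nu> g \<notin> B"
proof -
  obtain \<mu>' where \<mu>': "\<mu>' \<in> invariant_measures T" "integral\<^sup>L \<mu>' g \<noteq> integral\<^sup>L \<mu> g"
    using two by metis
  define H where "H x = (f x, g x)" for x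
  have Hc: "continuous_on UNIV H" unfolding H_def by (intro continuous_intros f g)
  have H: "integral\<^sup>L m H = (integral\<^sup>L m f, integral\<^sup>L m g)" if "m \<in> invariant_measures T" for m
    using integral_bounded_linear[OF bounded_linear_fst integrable_invariant[OF that Hc]]
      integral_bounded_linear[OF bounded_linear_snd integrable_invariant[OF that Hc]]
    by (simp add: H_def prod_eq_iff)
  define D where "D = dist (integral\<^sup>L \<mu>' f) (integral\<^sup>L \<mu> f)"
  \<comment> \<open>A mixture of weight \<open>u < s\<close> displaces the integral of
    \<open>f\<close> by \<open>u * D\<close>, which is below \<open>\<epsilon> / 2\<close>; the
    summand 1 covers the case \<open>D = 0\<close>.\<close>
  define s where "s = min 1 (\<epsilon> / 2 / (D + 1))"
  have D0: "D \<ge> 0" by (simp add: D_def)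
  have s: "0 < s" "s \<le> 1" using \<epsilon> D0 by (auto simp: s_def)
  define v where "v u = (1 - u) * integral\<^sup>L \<mu> g + u * integral\<^sup>L \<mu>' g" for u
  have "inj_on v {0<..<s}"
  proof (rule inj_onI)
    fix a b assume "v a = v b"
    then have "(a - b) * (integral\<^sup>L \<mu>' g - integral\<^sup>L \<mu> g) = 0" by (simp add: v_def algebra_simps)
    then show "a = b" using \<mu>'(2) by simp
  qed
  then have "infinite (v ` {0<..<s})" using s infinite_Ioo finite_imageD by blast
  then have "\<not> v ` {0<..<s} \<subseteq> B" using B finite_subset by metis
  then obtain u where u: "u \<in> {0<..<s}" "v u \<notin> B" by blast
  obtain m where m: "m \<in> invariant_measures T"
    and mH: "\<And>h :: 'a \<Rightarrow> 'b \<times> real. continuous_on UNIV h \<Longrightarrow>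
       integral\<^sup>L m h = (1 - u) *\<^sub>R integral\<^sup>L \<mu> h + u *\<^sub>R integral\<^sup>L \<mu>' h"
  proof (rule invariant_mixture[OF \<mu> \<mu>'(1)], goal_cases)
    show "0 \<le> u" "u \<le> 1" using u s by auto
  qed (rule that)
  have mg: "integral\<^sup>L m g = v u" and mf: "integral\<^sup>L m f = (1 - u) *\<^sub>R integral\<^sup>L \<mu> f + u *\<^sub>R integral\<^sup>L \<mu>' f"
    using mH[OF Hc] H[OF m] H[OF \<mu>] H[OF \<mu>'(1)] by (auto simp: v_def)
  have "integral\<^sup>L m f - integral\<^sup>L \<mu> f = u *\<^sub>R (integral\<^sup>L \<mu>' f - integral\<^sup>L \<mu> f)"
    unfolding mf by (simp add: algebra_simps)
  then have "dist (integral\<^sup>L m f) (integral\<^sup>L \<mu> f) = u * D" using u by (simp add: dist_norm D_def)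
  also have "\<dots> \<le> u * (D + 1)" using u by (intro mult_left_mono) auto
  also have "\<dots> < s * (D + 1)" using u D0 by (intro mult_strict_right_mono) auto
  also have "\<dots> \<le> \<epsilon> / 2 / (D + 1) * (D + 1)" using D0 by (intro mult_right_mono) (auto simp: s_def)
  also have "\<dots> = \<epsilon> / 2" using D0 by (simp add: field_simps)
  finally have d1: "dist (integral\<^sup>L m f) (integral\<^sup>L \<mu> f) < \<epsilon> / 2" .
  have "open (- B)" using B by (simp add: finite_imp_closed open_Compl)
  then obtain e where e: "e > 0" "ball (v u) e \<subseteq> - B" using u(2) openE by blast
  have "min e (\<epsilon> / 2) > 0" using e \<epsilon> by simp
  then obtain \<nu> where \<nu>: "\<nu> \<in> periodic_measures T" and d: "dist (integral\<^sup>L \<nu> H) (integral\<^sup>L m H) < min e (\<epsilon> / 2)"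
    using periodic_measures_approximate[OF m Hc] by blast
  have \<nu>i: "\<nu> \<in> invariant_measures T" using \<nu> by (simp add: periodic_measures_def)
  have "dist (integral\<^sup>L \<nu> f) (integral\<^sup>L m f) < \<epsilon> / 2" "dist (integral\<^sup>L \<nu> g) (integral\<^sup>L m g) < e"
    using d dist_fst_le[of "integral\<^sup>L \<nu> H" "integral\<^sup>L m H"] dist_snd_le[of "integral\<^sup>L \<nu> H" "integral\<^sup>L m H"]
    by (auto simp: H[OF m] H[OF \<nu>i])
  then have "dist (integral\<^sup>L \<nu> f) (integral\<^sup>L \<mu> f) < \<epsilon>" "integral\<^sup>L \<nu> g \<in> ball (v u) e"
    using d1 dist_triangle[of "integral\<^sup>L \<nu> f" "integral\<^sup>L \<mu> f" "integral\<^sup>L m f"] by (auto simp: mg dist_commute)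
  then show thesis using that[OF \<nu>] e(2) by blast
qed

text \<open>Induction on \<open>P\<close>, each new measure avoiding the \<open>g\<close>-integrals
  already used. These integrals serve as labels by which the averages of \<open>g\<close> will tell
  the orbits apart.\<close>

lemma distinguished_periodic_measures:
  fixes f :: "'a \<Rightarrow> 'b::euclidean_space" and g :: "'a \<Rightarrow> real"
  assumes f: "continuous_on UNIV f" and g: "continuous_on UNIV g"
    and two: "\<mu>\<^sub>1 \<in> invariant_measures T" "\<mu>\<^sub>2 \<in> invariant_measures T" "integral\<^sup>L \<mu>\<^sub>1 g \<noteq> integral\<^sup>L \<mu>\<^sub>2 g"
    and P: "finite P" and near: "\<And>p. p \<in> P \<Longrightarrow> \<exists>z\<in>integrals f. dist p z < \<epsilon>"
  shows "\<exists>\<nu>. (\<forall>p\<in>P. \<nu> p \<in> periodic_measures T \<and> dist (integral\<^sup>L (\<nu> p) f) p < \<epsilon>) \<and>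
           inj_on (\<lambda>p. integral\<^sup>L (\<nu> p) g) P"
  using P near
proof (induction P)
  case (insert p P)
  then obtain \<nu> where \<nu>: "\<And>q. q \<in> P \<Longrightarrow> \<nu> q \<in> periodic_measures T \<and> dist (integral\<^sup>L (\<nu> q) f) q < \<epsilon>"
    and inj: "inj_on (\<lambda>p. integral\<^sup>L (\<nu> p) g) P" by auto
  obtain \<mu> where \<mu>: "\<mu> \<in> invariant_measures T" "dist p (integral\<^sup>L \<mu> f) < \<epsilon>"
    using insert.prems[of p] by (auto simp: integrals_def)
  have "\<epsilon> - dist p (integral\<^sup>L \<mu> f) > 0" using \<mu>(2) by simp
  from periodic_measure_avoiding[OF f g two \<mu>(1) this, of "(\<lambda>p. integral\<^sup>L (\<nu> p) g) ` P"]
  obtain m where m: "m \<in> periodic_measures T" "dist (integral\<^sup>L m f) (integral\<^sup>L \<mu> f) < \<epsilon> - dist p (integral\<^sup>L \<mu> f)"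
    "integral\<^sup>L m g \<notin> (\<lambda>p. integral\<^sup>L (\<nu> p) g) ` P" using insert.hyps by auto
  have "dist (integral\<^sup>L m f) p < \<epsilon>"
    using m(2) dist_triangle2[of "integral\<^sup>L m f" p "integral\<^sup>L \<mu> f"] by linarith
  then have 1: "\<forall>q\<in>insert p P. (\<nu>(p := m)) q \<in> periodic_measures T \<and> dist (integral\<^sup>L ((\<nu>(p := m)) q) f) q < \<epsilon>"
    using \<nu> m(1) by auto
  have "(\<lambda>q. integral\<^sup>L ((\<nu>(p := m)) q) g) ` P = (\<lambda>p. integral\<^sup>L (\<nu> p) g) ` P"
    using insert.hyps by (intro image_cong) auto
  moreover have "inj_on (\<lambda>q. integral\<^sup>L ((\<nu>(p := m)) q) g) P"
    using inj insert.hyps by (subst inj_on_cong[of _ _ "\<lambda>p. integral\<^sup>L (\<nu> p) g"]) auto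
  ultimately have 2: "inj_on (\<lambda>q. integral\<^sup>L ((\<nu>(p := m)) q) g) (insert p P)"
    unfolding inj_on_insert using m(3) insert.hyps by simp
  from 1 2 show ?case by blast
qed simp

text \<open>The margin \<open>r\<close> puts long Birkhoff averages of \<open>f\<close> inside
  \<open>K\<close>, \<open>\<epsilon>\<close> bounds the shifts needed to reach points of
  \<open>K\<close>, and \<open>\<eta>\<close> is the mesh of the net that the new integrals must
  contain.\<close>

lemma integrals_approximate_body:
  fixes f :: "'a \<Rightarrow> 'b::euclidean_space" and g :: "'a \<Rightarrow> real"
  assumes f: "continuous_on UNIV f" and g: "continuous_on UNIV g"
    and two: "\<mu>\<^sub>1 \<in> invariant_measures T" "\<mu>\<^sub>2 \<in> invariant_measures T" "integral\<^sup>L \<mu>\<^sub>1 g \<noteq> integral\<^sup>L \<mu>\<^sub>2 g"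
    and K: "compact K" "convex K" and r: "r > 0" and inner: "\<And>z. z \<in> integrals f \<Longrightarrow> ball z r \<subseteq> K"
    and near: "\<And>p. p \<in> K \<Longrightarrow> \<exists>z\<in>integrals f. dist p z < \<epsilon>" and \<eta>: "\<eta> > 0"
  obtains G where "continuous_on UNIV G" "\<And>x. dist (G x) (f x) \<le> \<epsilon>" "integrals G \<subseteq> K"
    "\<And>p. p \<in> K \<Longrightarrow> \<exists>z\<in>integrals G. dist p z < \<eta>"
proof -
  have Kcl: "closed K" using K by (simp add: compact_imp_closed)
  have Kne: "K \<noteq> {}" using integrals_nonempty[of f] inner r by fastforce
  have e0: "\<epsilon> > 0" using Kne near by (metis all_not_in_conv order_le_less_trans zero_le_dist)
  obtain P where P: "finite P" "P \<subseteq> K" "K \<subseteq> (\<Union>p\<in>P. ball p \<eta>)"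
    using seq_compact_imp_totally_bounded K(1) \<eta> unfolding compact_eq_seq_compact_metric by metis
  have "\<exists>\<nu>. (\<forall>p\<in>P. \<nu> p \<in> periodic_measures T \<and> dist (integral\<^sup>L (\<nu> p) f) p < \<epsilon>) \<and>
           inj_on (\<lambda>p. integral\<^sup>L (\<nu> p) g) P"
    by (rule distinguished_periodic_measures[OF f g two P(1)]) (use near P(2) in blast)
  then obtain \<nu> where \<nu>: "\<And>p. p \<in> P \<Longrightarrow> \<nu> p \<in> periodic_measures T"
    and \<nu>d: "\<And>p. p \<in> P \<Longrightarrow> dist (integral\<^sup>L (\<nu> p) f) p < \<epsilon>"
    and inj: "inj_on (\<lambda>p. integral\<^sup>L (\<nu> p) g) P" by blast
  have "\<exists>k>0. \<forall>n>0. k dvd n \<longrightarrow> (AE y in \<nu> p. birkhoff_average T n f y = integral\<^sup>L (\<nu> p) f) \<and>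
      (AE y in \<nu> p. birkhoff_average T n g y = integral\<^sup>L (\<nu> p) g)" if "p \<in> P" for p
    by (rule periodic_measure_birkhoff[OF \<nu>[OF that], where 'b='b and 'c=real]) (use f g in blast)
  then obtain k where k0: "\<And>p. p \<in> P \<Longrightarrow> k p > 0"
    and k: "\<And>p n. p \<in> P \<Longrightarrow> n > 0 \<Longrightarrow> k p dvd n \<Longrightarrow> (AE y in \<nu> p. birkhoff_average T n f y = integral\<^sup>L (\<nu> p) f) \<and>
      (AE y in \<nu> p. birkhoff_average T n g y = integral\<^sup>L (\<nu> p) g)" by metis
  obtain N where N: "\<And>n x. n \<ge> N \<Longrightarrow> \<exists>z\<in>integrals f. dist (birkhoff_average T n f x) z < r"
    using birkhoff_average_near_integrals[OF f r] by blast
  \<comment> \<open>A common multiple of all periods; the factor \<open>Suc N\<close> makes it long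
    enough for the averages to lie in \<open>K\<close>.\<close>
  define n where "n = (\<Prod>p\<in>P. k p) * Suc N"
  have prod0: "(\<Prod>p\<in>P. k p) > 0" using k0 by (simp add: prod_pos)
  then have n: "n > 0" by (simp add: n_def)
  have "1 * Suc N \<le> n" unfolding n_def using prod0 by (intro mult_right_mono) auto
  then have nN: "n \<ge> N" by simp
  have kn: "k p dvd n" if "p \<in> P" for p using that P(1) by (simp add: n_def dvd_prod_eqI dvd_mult2)
  define A where "A = birkhoff_average T n f"
  define C where "C = birkhoff_average T n g"
  have Ac: "continuous_on UNIV A" and Cc: "continuous_on UNIV C"
    unfolding A_def C_def by (intro continuous_on_birkhoff_average continuous_T f g)+
  have AK: "A x \<in> K" for x using N[OF nN, of x] inner by (fastforce simp: A_def dist_commute)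
  define a where "a p = integral\<^sup>L (\<nu> p) g" for p
  define w where "w p = p - integral\<^sup>L (\<nu> p) f" for p
  have inja: "inj_on a P" using inj by (simp add: inj_on_def a_def)
  have "norm (w p) \<le> \<epsilon>" if "p \<in> P" for p
    using less_imp_le[OF \<nu>d[OF that]] by (simp add: w_def dist_norm norm_minus_commute)
  then have sub: "(w \<circ> the_inv_into P a) ` (a ` P) \<subseteq> cball 0 \<epsilon>"
    by (auto simp: the_inv_into_f_f[OF inja])
  \<comment> \<open>\<open>C\<close> takes the value \<open>a p\<close> on the orbit carrying \<open>\<nu> p\<close>, so a function of \<open>C\<close> can prescribe
    independent values on the different orbits.\<close>
  obtain \<Theta> where \<Theta>: "continuous_on UNIV \<Theta>" "\<Theta> ` UNIV \<subseteq> cball 0 \<epsilon>"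
    "\<And>t. t \<in> a ` P \<Longrightarrow> \<Theta> t = (w \<circ> the_inv_into P a) t"
    by (rule Dugundji[OF convex_cball _ _ _ sub, of UNIV])
       (use e0 P(1) in \<open>auto simp: finite_imp_closed continuous_on_finite\<close>)
  have \<Theta>a: "\<Theta> (a p) = w p" if "p \<in> P" for p using \<Theta>(3) that by (simp add: the_inv_into_f_f[OF inja])
  define Q where "Q x = closest_point K (A x + \<Theta> (C x))" for x
  \<comment> \<open>The term \<open>f - A\<close> integrates to 0 against every invariant measure.
    Thus \<open>G\<close> has the integrals of the \<open>K\<close>-valued function
    \<open>Q\<close>, yet differs from \<open>f\<close> only by \<open>Q - A\<close>, which is small
    because the projection to \<open>K\<close> fixes \<open>A\<close> and does not increase
    distances.\<close>
  define G where "G x = f x - A x + Q x" for x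
  have Qc: "continuous_on UNIV Q" unfolding Q_def
    by (intro continuous_on_compose2[OF continuous_on_closest_point[OF K(2) Kcl Kne, of UNIV]]
        continuous_on_add Ac continuous_on_compose2[OF \<Theta>(1) Cc]) auto
  have Gc: "continuous_on UNIV G" unfolding G_def by (intro continuous_intros f Ac Qc)
  have QK: "Q x \<in> K" for x unfolding Q_def by (rule closest_point_in_set[OF Kcl Kne])
  have int: "integral\<^sup>L \<mu> G = integral\<^sup>L \<mu> Q" if "\<mu> \<in> invariant_measures T" for \<mu>
    unfolding G_def using that f Ac Qc integral_birkhoff_average[OF that f n]
    by (simp add: integrable_invariant A_def)
  show thesis
  proof
    show "dist (G x) (f x) \<le> \<epsilon>" for x
    proof -
      have "dist (G x) (f x) = dist (closest_point K (A x + \<Theta> (C x))) (closest_point K (A x))"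
        using closest_point_self[OF AK] by (simp add: G_def Q_def dist_norm algebra_simps)
      also have "\<dots> \<le> dist (A x + \<Theta> (C x)) (A x)" by (rule closest_point_lipschitz[OF K(2) Kcl Kne])
      also have "\<dots> \<le> \<epsilon>" using \<Theta>(2) by (auto simp: dist_norm image_subset_iff)
      finally show ?thesis .
    qed
    show "integrals G \<subseteq> K"
      using prob_space.integral_in_closed_convex[OF invariantD(1) Kcl K(2) integrable_invariant[OF _ Qc] QK]
      by (auto simp: integrals_def int)
    fix q assume "q \<in> K"
    then obtain p where p: "p \<in> P" "dist q p < \<eta>" using P(3) by (auto simp: dist_commute)
    have \<nu>i: "\<nu> p \<in> invariant_measures T" using \<nu>[OF p(1)] by (simp add: periodic_measures_def)
    interpret prob_space "\<nu> p" using invariantD[OF \<nu>i] by simp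
    have "AE y in \<nu> p. Q y = p"
      using k[OF p(1) n kn[OF p(1)], THEN conjunct1] k[OF p(1) n kn[OF p(1)], THEN conjunct2]
    proof eventually_elim
      case (elim y)
      then have "A y + \<Theta> (C y) = p" using \<Theta>a[OF p(1)] by (simp add: A_def C_def a_def w_def)
      then show ?case using p(1) P(2) closest_point_self by (auto simp: Q_def)
    qed
    then have "integral\<^sup>L (\<nu> p) Q = (\<integral>y. p \<partial>\<nu> p)"
      by (intro integral_cong_AE) (use integrable_invariant[OF \<nu>i Qc] in auto)
    then have "p \<in> integrals G" using int[OF \<nu>i] \<nu>i by (auto simp: integrals_def prob_space intro!: image_eqI[of _ _ "\<nu> p"])
    then show "\<exists>z\<in>integrals G. dist q z < \<eta>" using p(2) by blast
  qed (rule Gc)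
qed

end

section \<open>Approximately regular convex bodies\<close>

text \<open>The unit normal bundle of \<open>K\<close>. Normalisation makes limits of normals
  nonzero.\<close>

definition outer_normals :: "'b::euclidean_space set \<Rightarrow> ('b \<times> 'b) set" where
  "outer_normals K = {(y, v). y \<in> K \<and> norm v = 1 \<and> (\<forall>k\<in>K. v \<bullet> k \<le> v \<bullet> y)}"

text \<open>The inequalities are strict so that violations form a closed condition, as the
  compactness argument for stability requires.\<close>

definition almost_regular :: "real \<Rightarrow> 'b::euclidean_space set \<Rightarrow> bool" where
  "almost_regular \<epsilon> K \<longleftrightarrow>
     (\<forall>y y' v. (y, v) \<in> outer_normals K \<longrightarrow> (y', v) \<in> outer_normals K \<longrightarrow> dist y y' < \<epsilon>) \<and>
     (\<forall>y v v'. (y, v) \<in> outer_normals K \<longrightarrow> (y, v') \<in> outer_normals K \<longrightarrow> dist v v' < \<epsilon>)"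

text \<open>If sets \<open>L n\<close> ever closer to \<open>K\<close> violated the condition, the
  violating points and unit normals would subconverge, and closedness would turn the limits into a
  violation for \<open>K\<close> itself.\<close>

lemma almost_regular_stable:
  fixes K :: "'b::euclidean_space set"
  assumes K: "compact K" and reg: "almost_regular \<epsilon> K"
  obtains \<delta> where "\<delta> > 0"
    "\<And>L. \<lbrakk>\<And>y. y \<in> L \<Longrightarrow> \<exists>k\<in>K. dist y k < \<delta>; \<And>k. k \<in> K \<Longrightarrow> \<exists>y\<in>L. dist k y < \<delta>\<rbrakk> \<Longrightarrow> almost_regular \<epsilon> L"
proof (rule ccontr)
  assume no: "\<not> thesis"
  note suffices = that
  \<comment> \<open>Both kinds of violation, distant points with one normal and distant normals at
    one point, are encoded in a single closed set of quadruples.\<close>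
  define V where "V = {(y::'b, y'::'b, v::'b, v'::'b). (v = v' \<and> dist y y' \<ge> \<epsilon>) \<or> (y = y' \<and> dist v v' \<ge> \<epsilon>)}"
  have "closed V" unfolding V_def case_prod_unfold
    by (intro closed_Collect_disj closed_Collect_conj closed_Collect_eq closed_Collect_le continuous_intros)
  have "\<exists>L y y' v v'. (\<forall>y\<in>L. \<exists>k\<in>K. dist y k < 1 / real (Suc n)) \<and> (\<forall>k\<in>K. \<exists>y\<in>L. dist k y < 1 / real (Suc n)) \<and>
      (y, v) \<in> outer_normals L \<and> (y', v') \<in> outer_normals L \<and> (y, y', v, v') \<in> V" for n
  proof -
    obtain L where L: "\<And>y. y \<in> L \<Longrightarrow> \<exists>k\<in>K. dist y k < 1 / real (Suc n)" "\<And>k. k \<in> K \<Longrightarrow> \<exists>y\<in>L. dist k y < 1 / real (Suc n)"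
      and nr: "\<not> almost_regular \<epsilon> L"
      using no suffices[of "1 / real (Suc n)"] by (metis of_nat_0_less_iff zero_less_Suc zero_less_divide_1_iff)
    from nr obtain y y' v v' where "(y, v) \<in> outer_normals L" "(y', v') \<in> outer_normals L" "(y, y', v, v') \<in> V"
      unfolding almost_regular_def V_def by (auto simp: not_less)
    with L show ?thesis by metis
  qed
  then obtain L y y' v v' where L1: "\<And>n z. z \<in> L n \<Longrightarrow> \<exists>k\<in>K. dist z k < 1 / real (Suc n)"
    and L2: "\<And>n k. k \<in> K \<Longrightarrow> \<exists>z\<in>L n. dist k z < 1 / real (Suc n)"
    and N: "\<And>n. (y n, v n) \<in> outer_normals (L n)" "\<And>n. (y' n, v' n) \<in> outer_normals (L n)"
    and V: "\<And>n. (y n, y' n, v n, v' n) \<in> V" by metis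
  have y: "y n \<in> L n" "y' n \<in> L n" for n using N by (auto simp: outer_normals_def)
  have v: "v n \<in> sphere 0 1" "v' n \<in> sphere 0 1" for n using N by (auto simp: outer_normals_def)
  \<comment> \<open>The points \<open>y n\<close> lie in \<open>L n\<close> rather than in
    \<open>K\<close>. Compactness is applied to nearby points of \<open>K\<close>, which have the
    same limits.\<close>
  obtain z where z: "\<And>n. z n \<in> K" "\<And>n. dist (y n) (z n) < 1 / real (Suc n)" using L1[OF y(1)] by metis
  obtain z' where z': "\<And>n. z' n \<in> K" "\<And>n. dist (y' n) (z' n) < 1 / real (Suc n)" using L1[OF y(2)] by metis
  have "compact (K \<times> K \<times> sphere (0::'b) 1 \<times> sphere (0::'b) 1)" by (intro compact_Times K compact_sphere)
  moreover define q where "q n = (z n, z' n, v n, v' n)" for n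
  moreover have "q n \<in> K \<times> K \<times> sphere 0 1 \<times> sphere 0 1" for n using z z' v by (auto simp: q_def)
  ultimately obtain l r where l: "l \<in> K \<times> K \<times> sphere 0 1 \<times> sphere 0 1" and r: "strict_mono r" and ql: "(q \<circ> r) \<longlonglongrightarrow> l"
    unfolding compact_def by metis
  obtain a a' w w' where "l = (a, a', w, w')" by (rule prod_cases4)
  then have lim: "(\<lambda>n. (z (r n), z' (r n), v (r n), v' (r n))) \<longlonglongrightarrow> (a, a', w, w')"
    and mem: "a \<in> K" "a' \<in> K" "norm w = 1" "norm w' = 1"
    using l ql by (auto simp: o_def q_def)
  have za: "(\<lambda>n. z (r n)) \<longlonglongrightarrow> a" "(\<lambda>n. z' (r n)) \<longlonglongrightarrow> a'" and vw: "(\<lambda>n. v (r n)) \<longlonglongrightarrow> w" "(\<lambda>n. v' (r n)) \<longlonglongrightarrow> w'"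
    using tendsto_fst[OF lim] tendsto_fst[OF tendsto_snd[OF lim]] tendsto_fst[OF tendsto_snd[OF tendsto_snd[OF lim]]]
      tendsto_snd[OF tendsto_snd[OF tendsto_snd[OF lim]]] by simp_all
  have inv: "(\<lambda>n. 1 / real (Suc (r n))) \<longlonglongrightarrow> 0"
    using LIMSEQ_subseq_LIMSEQ[OF LIMSEQ_inverse_real_of_nat r] by (simp add: o_def inverse_eq_divide)
  have close: "p \<longlonglongrightarrow> c" if "q \<longlonglongrightarrow> c" "\<And>n. dist (p n) (q n) < 1 / real (Suc (r n))" for p q :: "nat \<Rightarrow> 'b" and c
  proof -
    have "(\<lambda>n. p n - q n) \<longlonglongrightarrow> 0"
      by (rule Lim_null_comparison[OF _ inv]) (use that(2) in \<open>auto simp: dist_norm intro!: always_eventually less_imp_le\<close>)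
    from tendsto_add[OF this that(1)] show ?thesis by simp
  qed
  have ya: "(\<lambda>n. y (r n)) \<longlonglongrightarrow> a" "(\<lambda>n. y' (r n)) \<longlonglongrightarrow> a'"
    by (rule close[OF za(1) z(2)], rule close[OF za(2) z'(2)])
  have normal: "(b, u) \<in> outer_normals K"
    if "\<And>n. (p n, q n) \<in> outer_normals (L (r n))" "p \<longlonglongrightarrow> b" "q \<longlonglongrightarrow> u" "b \<in> K" "norm u = 1" for p q b u
  proof -
    note pq = that
    have "u \<bullet> k \<le> u \<bullet> b" if k: "k \<in> K" for k
    proof -
      have "\<forall>n. \<exists>z. z \<in> L (r n) \<and> dist k z < 1 / real (Suc (r n))" using L2[OF k] by blast
      then obtain l where l: "\<And>n. l n \<in> L (r n)" "\<And>n. dist k (l n) < 1 / real (Suc (r n))" by metis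
      have lk: "l \<longlonglongrightarrow> k" by (rule close[OF tendsto_const]) (use l(2) in \<open>simp add: dist_commute\<close>)
      have le: "q n \<bullet> l n \<le> q n \<bullet> p n" for n using pq(1)[of n] l(1)[of n] by (auto simp: outer_normals_def)
      show ?thesis
        by (rule LIMSEQ_le[OF tendsto_inner[OF pq(3) lk] tendsto_inner[OF pq(3) pq(2)]]) (use le in auto)
    qed
    then show ?thesis using pq(4,5) by (simp add: outer_normals_def)
  qed
  have "(a, w) \<in> outer_normals K" "(a', w') \<in> outer_normals K"
    using normal[OF N(1) ya(1) vw(1)] normal[OF N(2) ya(2) vw(2)] mem by auto
  moreover have "(a, a', w, w') \<in> V"
    by (rule closed_sequentially[OF \<open>closed V\<close>, of "\<lambda>n. (y (r n), y' (r n), v (r n), v' (r n))"])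
       (use V ya vw in \<open>auto intro!: tendsto_Pair\<close>)
  ultimately show False using reg unfolding almost_regular_def V_def by (auto simp: not_less[symmetric])
qed

section \<open>From almost regularity to strict convexity and a C^1 boundary\<close>

text \<open>A hyperplane supporting \<open>K\<close> at the midpoint of a boundary segment contains
  both endpoints. They then share an outer normal, against almost regularity with
  \<open>\<epsilon>\<close> equal to their distance.\<close>

lemma strictly_convexI:
  fixes K :: "'b::euclidean_space set"
  assumes K: "K \<noteq> {}" "compact K" "convex K" and reg: "\<And>\<epsilon>. \<epsilon> > 0 \<Longrightarrow> almost_regular \<epsilon> K"
  shows "strictly_convex K"
  unfolding strictly_convex_def
proof (intro conjI allI impI K)
  fix a b :: 'b assume "a \<noteq> b"
  show "\<not> closed_segment a b \<subseteq> frontier K"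
  proof
    assume seg: "closed_segment a b \<subseteq> frontier K"
    define m where "m = midpoint a b"
    have fK: "frontier K \<subseteq> K" using K(2) by (simp add: compact_imp_closed frontier_subset_closed)
    have "m \<in> closed_segment a b" by (simp add: m_def)
    then have ab: "a \<in> K" "b \<in> K" and mf: "m \<in> frontier K" and mK: "m \<in> K"
      using seg fK by auto
    have ri: "m \<notin> interior K" using mf by (simp add: frontier_def)
    \<comment> \<open>The supporting hyperplane theorem speaks of the relative boundary. If the
      interior is empty, a hyperplane containing all of \<open>K\<close> supports it at every
      point.\<close>
    obtain v where "v \<noteq> 0" and v: "\<And>x. x \<in> K \<Longrightarrow> v \<bullet> x \<le> v \<bullet> m"
    proof (cases "interior K = {}")
      case True
      then obtain u c where "u \<noteq> 0" and u: "K \<subseteq> {x. u \<bullet> x = c}" using empty_interior_subset_hyperplane[OF K(3)] by blast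
      moreover have "u \<bullet> x = c" if "x \<in> K" for x using u that by blast
      ultimately show ?thesis using mK by (intro that[of u]) auto
    next
      case False
      then have "m \<notin> rel_interior K" using ri by (simp add: rel_interior_nonempty_interior)
      moreover have "m \<in> closure K" using mK closure_subset by auto
      ultimately obtain u where "u \<noteq> 0" "\<And>x. x \<in> closure K \<Longrightarrow> u \<bullet> m \<le> u \<bullet> x"
        using supporting_hyperplane_rel_boundary[of "closure K" m] K mK by (metis closure_closed compact_imp_closed)
      then show ?thesis using closure_subset by (intro that[of "- u"]) auto
    qed
    define w where "w = v /\<^sub>R norm v"
    have w: "norm w = 1" "w \<bullet> x \<le> w \<bullet> m" if "x \<in> K" for x
      using \<open>v \<noteq> 0\<close> v[OF that] by (auto simp: w_def intro: mult_left_mono)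
    have "w \<bullet> m = (w \<bullet> a + w \<bullet> b) / 2" by (simp add: m_def midpoint_def inner_add_right)
    then have "w \<bullet> a = w \<bullet> m" "w \<bullet> b = w \<bullet> m" using w(2)[OF ab(1)] w(2)[OF ab(2)] by auto
    then have "(a, w) \<in> outer_normals K" "(b, w) \<in> outer_normals K" using w ab by (auto simp: outer_normals_def)
    then have "dist a b < dist a b" using reg[of "dist a b"] \<open>a \<noteq> b\<close> unfolding almost_regular_def by auto
    then show False by simp
  qed
qed

text \<open>A set inside a hyperplane has both \<open>v\<close> and \<open>- v\<close> as outer
  normals at each of its points, and these are at distance 2.\<close>

lemma interior_nonempty_of_almost_regular:
  fixes K :: "'b::euclidean_space set"
  assumes K: "K \<noteq> {}" "convex K" and reg: "almost_regular 1 K"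
  shows "interior K \<noteq> {}"
proof
  assume "interior K = {}"
  then obtain u c where u: "u \<noteq> 0" "K \<subseteq> {x. u \<bullet> x = c}" using empty_interior_subset_hyperplane[OF K(2)] by blast
  obtain y where y: "y \<in> K" using K by blast
  define v where "v = u /\<^sub>R norm u"
  have v: "norm v = 1" "\<And>x. x \<in> K \<Longrightarrow> v \<bullet> x = v \<bullet> y" using u y by (auto simp: v_def)
  have "v \<bullet> k \<le> v \<bullet> y" "- v \<bullet> k \<le> - v \<bullet> y" if "k \<in> K" for k using v(2)[OF that] by simp_all
  then have "(y, v) \<in> outer_normals K" "(y, - v) \<in> outer_normals K" using v(1) y by (auto simp: outer_normals_def)
  then have "dist v (- v) < 1" using reg unfolding almost_regular_def by blast
  moreover have "v - - v = 2 *\<^sub>R v" by (simp add: scaleR_2)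
  then have "dist v (- v) = 2" unfolding dist_norm using v by simp
  ultimately show False by simp
qed

text \<open>By compactness, maximisers at points tending to \<open>y\<close> subconverge to a
  maximiser at \<open>y\<close>, which uniqueness identifies as \<open>\<sigma> y\<close>.\<close>

lemma continuous_unique_maximiser:
  fixes \<sigma> :: "'b::euclidean_space \<Rightarrow> 'b"
  assumes P: "compact P" and \<sigma>: "\<And>y. \<sigma> y \<in> P" "\<And>y s. s \<in> P \<Longrightarrow> s \<bullet> y \<le> \<sigma> y \<bullet> y"
    and uniq: "\<And>t. \<lbrakk>t \<in> P; t \<bullet> y = \<sigma> y \<bullet> y\<rbrakk> \<Longrightarrow> t = \<sigma> y"
  shows "isCont \<sigma> y"
proof (rule ccontr)
  assume "\<not> isCont \<sigma> y"
  then obtain e where e: "e > 0" "\<And>d. d > 0 \<Longrightarrow> \<exists>x. dist x y < d \<and> dist (\<sigma> x) (\<sigma> y) \<ge> e"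
    unfolding continuous_at_eps_delta by (metis not_less)
  have "\<forall>n. \<exists>x. dist x y < 1 / real (Suc n) \<and> dist (\<sigma> x) (\<sigma> y) \<ge> e" using e(2) by simp
  then obtain x where x: "\<And>n. dist (x n) y < 1 / real (Suc n)" and far: "\<And>n. dist (\<sigma> (x n)) (\<sigma> y) \<ge> e" by metis
  have xy: "x \<longlonglongrightarrow> y"
    by (rule tendsto_dist_iff[THEN iffD2], rule tendsto_sandwich[OF _ _ tendsto_const LIMSEQ_inverse_real_of_nat])
       (use x in \<open>auto simp: inverse_eq_divide intro!: always_eventually less_imp_le\<close>)
  obtain t r where t: "t \<in> P" "strict_mono r" "(\<lambda>n. \<sigma> (x (r n))) \<longlonglongrightarrow> t"
    using P[unfolded compact_def, THEN spec, of "\<lambda>n. \<sigma> (x n)"] \<sigma>(1) by (auto simp: o_def)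
  have xr: "(\<lambda>n. x (r n)) \<longlonglongrightarrow> y" using LIMSEQ_subseq_LIMSEQ[OF xy t(2)] by (simp add: o_def)
  have "\<sigma> y \<bullet> y \<le> t \<bullet> y"
    by (rule LIMSEQ_le[OF tendsto_inner[OF tendsto_const xr] tendsto_inner[OF t(3) xr]]) (use \<sigma> in auto)
  then have "t = \<sigma> y" by (intro uniq t(1) antisym \<sigma>(2))
  then have "\<forall>\<^sub>F n in sequentially. dist (\<sigma> (x (r n))) (\<sigma> y) < e" using tendstoD[OF t(3) e(1)] by simp
  then obtain n where "dist (\<sigma> (x (r n))) (\<sigma> y) < e" using eventually_happens'[OF sequentially_bot] by blast
  with far show False by (metis not_less)
qed

text \<open>The envelope theorem: maximality at both points squeezes the linearisation error between
  0 and \<open>(\<sigma> y - \<sigma> x) \<bullet> (y - x)\<close>.\<close>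

lemma GDERIV_maximiser:
  fixes \<sigma> :: "'b::euclidean_space \<Rightarrow> 'b"
  assumes \<sigma>: "\<And>y. \<sigma> y \<in> P" "\<And>y s. s \<in> P \<Longrightarrow> s \<bullet> y \<le> \<sigma> y \<bullet> y" and c: "isCont \<sigma> x"
  shows "GDERIV (\<lambda>y. \<sigma> y \<bullet> y) x :> \<sigma> x"
  unfolding gderiv_def has_derivative_at_alt
proof (intro conjI allI impI bounded_linear_inner_left)
  fix e :: real assume "e > 0"
  then obtain d where d: "d > 0" "\<And>y. dist y x < d \<Longrightarrow> dist (\<sigma> y) (\<sigma> x) < e"
    using c unfolding continuous_at_eps_delta by metis
  show "\<exists>d>0. \<forall>y. norm (y - x) < d \<longrightarrow> norm (\<sigma> y \<bullet> y - \<sigma> x \<bullet> x - (y - x) \<bullet> \<sigma> x) \<le> e * norm (y - x)"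
  proof (intro exI conjI allI impI)
    fix y assume "norm (y - x) < d"
    then have n: "norm (\<sigma> y - \<sigma> x) \<le> e" using d(2)[of y] by (simp add: dist_norm)
    have "\<sigma> y \<bullet> y - \<sigma> x \<bullet> x - (y - x) \<bullet> \<sigma> x \<ge> 0"
      using \<sigma>(2)[OF \<sigma>(1)[of x], of y] by (simp add: inner_diff_left inner_diff_right inner_commute[of _ "\<sigma> x"])
    moreover have "\<sigma> y \<bullet> y - \<sigma> x \<bullet> x - (y - x) \<bullet> \<sigma> x \<le> (\<sigma> y - \<sigma> x) \<bullet> (y - x)"
      using \<sigma>(2)[OF \<sigma>(1)[of y], of x] by (simp add: inner_diff_left inner_diff_right inner_commute[of _ "\<sigma> x"])
    moreover have "(\<sigma> y - \<sigma> x) \<bullet> (y - x) \<le> norm (\<sigma> y - \<sigma> x) * norm (y - x)" by (rule norm_cauchy_schwarz)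
    moreover have "norm (\<sigma> y - \<sigma> x) * norm (y - x) \<le> e * norm (y - x)" using n by (intro mult_right_mono) auto
    ultimately show "norm (\<sigma> y \<bullet> y - \<sigma> x \<bullet> x - (y - x) \<bullet> \<sigma> x) \<le> e * norm (y - x)" by simp
  qed (rule d(1))
qed

text \<open>The boundary is the unit level set of the gauge of \<open>K\<close> about an interior
  point \<open>c\<close>. Unique normals make the gauge continuously differentiable off
  \<open>c\<close>, so one defining function on the complement of \<open>c\<close> serves all
  boundary points.\<close>

lemma C1_boundaryI:
  fixes K :: "'b::euclidean_space set"
  assumes K: "compact K" "convex K" and int: "interior K \<noteq> {}" and reg: "\<And>\<epsilon>. \<epsilon> > 0 \<Longrightarrow> almost_regular \<epsilon> K"
  shows "C1_boundary K"
proof -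
  have Kcl: "closed K" using K by (simp add: compact_imp_closed)
  obtain c where c: "c \<in> interior K" using int by blast
  then obtain \<rho> where \<rho>: "\<rho> > 0" "cball c \<rho> \<subseteq> K" using mem_interior_cball by blast
  have cK: "c \<in> K" using c interior_subset by blast
  \<comment> \<open>The polar body of \<open>K - c\<close>; its support function \<open>\<gamma>\<close> is the gauge of \<open>K - c\<close>, and uniqueness of
    outer normals of \<open>K\<close> is uniqueness of the maximiser \<open>\<sigma>\<close>.\<close>
  define P where "P = {s. \<forall>k\<in>K. s \<bullet> (k - c) \<le> 1}"
  have PB: "norm s \<le> 1 / \<rho>" if "s \<in> P" for s
  proof (cases "s = 0")
    case False
    have "c + (\<rho> / norm s) *\<^sub>R s \<in> K" using \<rho> False by (intro subsetD[OF \<rho>(2)]) (simp add: dist_norm)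
    then have "s \<bullet> ((\<rho> / norm s) *\<^sub>R s) \<le> 1" using that unfolding P_def by force
    then have "\<rho> * norm s \<le> 1" using False by (simp add: dot_square_norm power2_eq_square)
    then show ?thesis using \<rho> by (simp add: field_simps)
  qed (use \<rho> in simp)
  have "P = (\<Inter>k\<in>K. {s. s \<bullet> (k - c) \<le> 1})" by (auto simp: P_def)
  moreover have "closed {s. s \<bullet> (k - c) \<le> 1}" for k by (intro closed_Collect_le continuous_intros)
  ultimately have "closed P" by auto
  moreover have "bounded P" using PB by (auto simp: bounded_iff)
  ultimately have Pc: "compact P" by (simp add: compact_eq_bounded_closed)
  have "0 \<in> P" by (simp add: P_def)
  have "\<exists>s\<in>P. \<forall>t\<in>P. t \<bullet> y \<le> s \<bullet> y" for y
    by (rule continuous_attains_sup[OF Pc]) (use \<open>0 \<in> P\<close> in \<open>auto intro: continuous_intros\<close>)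
  then obtain \<sigma> where \<sigma>: "\<And>y. \<sigma> y \<in> P" "\<And>y s. s \<in> P \<Longrightarrow> s \<bullet> y \<le> \<sigma> y \<bullet> y" by metis
  define \<gamma> where "\<gamma> y = \<sigma> y \<bullet> y" for y
  \<comment> \<open>This is the bipolar theorem: a functional separating \<open>c + x\<close> from
    \<open>K\<close>, divided by \<open>- t\<close> where \<open>t\<close> is its gap at
    \<open>c\<close>, lies in \<open>P\<close> and exceeds 1 at \<open>x\<close>.\<close>
  have mem_iff: "c + x \<in> K \<longleftrightarrow> \<gamma> x \<le> 1" for x
  proof
    show "c + x \<in> K \<Longrightarrow> \<gamma> x \<le> 1" using \<sigma>(1)[of x] unfolding P_def \<gamma>_def by force
    assume g: "\<gamma> x \<le> 1"
    show "c + x \<in> K"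
    proof (rule ccontr)
      assume "c + x \<notin> K"
      then obtain a b where ab: "a \<bullet> (c + x) < b" "\<And>k. k \<in> K \<Longrightarrow> b < a \<bullet> k"
        using separating_hyperplane_closed_point[OF K(2) Kcl] by blast
      define t where "t = a \<bullet> c - b"
      have t: "t > 0" using ab(2)[OF cK] by (simp add: t_def)
      define s where "s = (- 1 / t) *\<^sub>R a"
      have "s \<in> P" unfolding P_def
      proof clarify
        fix k assume "k \<in> K"
        from ab(2)[OF this] have "a \<bullet> c - a \<bullet> k < t" by (simp add: t_def)
        then show "s \<bullet> (k - c) \<le> 1" using t by (simp add: s_def inner_diff_right field_simps)
      qed
      moreover have "s \<bullet> x > 1" using ab(1) t by (simp add: s_def t_def inner_add_right field_simps)
      ultimately show False using \<sigma>(2)[of s x] g by (simp add: \<gamma>_def)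
    qed
  qed
  obtain R where R: "\<And>k. k \<in> K \<Longrightarrow> norm (k - c) \<le> R"
    using K(1) compact_imp_bounded[OF compact_translation_subtract[of K c]] by (auto simp: bounded_iff)
  have R0: "R \<ge> 0" using R[OF cK] by simp
  have pos: "\<gamma> y > 0" if "y \<noteq> 0" for y
  proof -
    \<comment> \<open>A short multiple of \<open>y\<close> belongs to \<open>P\<close> because
      \<open>K\<close> lies within \<open>R\<close> of \<open>c\<close>; using \<open>R + 1\<close>
      avoids division by zero.\<close>
    define s where "s = (1 / (norm y * (R + 1))) *\<^sub>R y"
    have ns: "norm s = 1 / (R + 1)" using that R0 by (simp add: s_def)
    have "s \<in> P" unfolding P_def
    proof clarify
      fix k assume "k \<in> K"
      have "s \<bullet> (k - c) \<le> norm s * norm (k - c)" by (rule norm_cauchy_schwarz)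
      also have "\<dots> \<le> norm s * R" using R[OF \<open>k \<in> K\<close>] by (intro mult_left_mono) auto
      also have "\<dots> \<le> 1" using R0 by (simp add: ns)
      finally show "s \<bullet> (k - c) \<le> 1" .
    qed
    moreover have "s \<bullet> y > 0" using that R0 by (simp add: s_def)
    ultimately show ?thesis using \<sigma>(2)[of s y] by (simp add: \<gamma>_def)
  qed
  have uniq: "t = \<sigma> y" if t: "t \<in> P" "t \<bullet> y = \<sigma> y \<bullet> y" and "y \<noteq> 0" for t y
  proof -
    \<comment> \<open>Scale \<open>y\<close> to gauge 1. Both maximisers then give outer normals of
      \<open>K\<close> at \<open>c + z\<close>, so they have the same direction, and their common
      value 1 at \<open>z\<close> forces equal length.\<close>
    define z where "z = y /\<^sub>R \<gamma> y"
    have g: "\<gamma> y > 0" by (rule pos[OF \<open>y \<noteq> 0\<close>])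
    have one: "t \<bullet> z = 1" "\<sigma> y \<bullet> z = 1" using g t by (auto simp: z_def \<gamma>_def)
    have "\<gamma> z \<le> 1"
      using \<sigma>(2)[OF \<sigma>(1)[of z], of y] g by (simp add: \<gamma>_def z_def field_simps)
    then have zK: "c + z \<in> K" by (simp add: mem_iff)
    have nor: "(c + z, s /\<^sub>R norm s) \<in> outer_normals K" if s: "s \<in> P" "s \<bullet> z = 1" for s
    proof -
      have "s \<noteq> 0" using s by auto
      moreover have "s \<bullet> k \<le> s \<bullet> (c + z)" if "k \<in> K" for k
      proof -
        have "s \<bullet> (k - c) \<le> 1" using s(1) that by (auto simp: P_def)
        then show ?thesis using s(2) by (simp add: inner_diff_right inner_add_right)
      qed
      ultimately show ?thesis using zK by (auto simp: outer_normals_def intro!: mult_left_mono)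
    qed
    have "dist (t /\<^sub>R norm t) (\<sigma> y /\<^sub>R norm (\<sigma> y)) < \<epsilon>" if "\<epsilon> > 0" for \<epsilon>
      using reg[OF that] nor[OF t(1) one(1)] nor[OF \<sigma>(1) one(2)] unfolding almost_regular_def by blast
    then have eq: "t /\<^sub>R norm t = \<sigma> y /\<^sub>R norm (\<sigma> y)" by (metis dist_eq_0_iff less_irrefl zero_less_dist_iff)
    then have "(t /\<^sub>R norm t) \<bullet> z = (\<sigma> y /\<^sub>R norm (\<sigma> y)) \<bullet> z" by simp
    then have "norm t = norm (\<sigma> y)" using one by simp
    moreover have "norm t \<noteq> 0" using one by auto
    ultimately show "t = \<sigma> y" using eq by simp
  qed
  have cont: "isCont \<sigma> y" if "y \<noteq> 0" for y
    by (rule continuous_unique_maximiser[OF Pc \<sigma>]) (use uniq that in auto)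
  have interior: "c + x \<in> interior K \<longleftrightarrow> \<gamma> x < 1" for x
  proof
    assume g: "\<gamma> x < 1"
    \<comment> \<open>Elements of \<open>P\<close> have norm at most \<open>1 / \<rho>\<close>, so a
      displacement \<open>h\<close> raises the gauge by at most
      \<open>norm h / \<rho>\<close>.\<close>
    have "ball (c + x) ((1 - \<gamma> x) * \<rho>) \<subseteq> K"
    proof
      fix w assume w: "w \<in> ball (c + x) ((1 - \<gamma> x) * \<rho>)"
      define h where "h = w - (c + x)"
      have h: "norm h < (1 - \<gamma> x) * \<rho>" using w by (simp add: h_def dist_norm norm_minus_commute)
      have "\<gamma> (x + h) = \<sigma> (x + h) \<bullet> x + \<sigma> (x + h) \<bullet> h" by (simp add: \<gamma>_def inner_add_right)
      also have "\<sigma> (x + h) \<bullet> x \<le> \<gamma> x" using \<sigma> by (simp add: \<gamma>_def)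
      also have "\<sigma> (x + h) \<bullet> h \<le> norm (\<sigma> (x + h)) * norm h" by (rule norm_cauchy_schwarz)
      also have "\<dots> \<le> (1 / \<rho>) * norm h" by (intro mult_right_mono PB \<sigma>) auto
      also have "\<dots> \<le> 1 - \<gamma> x" using h \<rho>(1) by (simp add: field_simps)
      finally have "\<gamma> (x + h) \<le> 1" by simp
      then have "c + (x + h) \<in> K" by (simp add: mem_iff)
      then show "w \<in> K" by (simp add: h_def)
    qed
    moreover have "c + x \<in> ball (c + x) ((1 - \<gamma> x) * \<rho>)" using g \<rho> by simp
    ultimately show "c + x \<in> interior K" by (meson interiorI open_ball)
  next
    assume i: "c + x \<in> interior K"
    show "\<gamma> x < 1"
    proof (cases "x = 0")
      case False
      obtain e where e: "e > 0" "cball (c + x) e \<subseteq> K" using i mem_interior_cball by blast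
      define \<tau> where "\<tau> = e / norm x"
      have \<tau>: "\<tau> > 0" using e False by (simp add: \<tau>_def)
      have "c + (1 + \<tau>) *\<^sub>R x \<in> cball (c + x) e" using e False by (simp add: dist_norm scaleR_add_left \<tau>_def)
      then have "\<gamma> ((1 + \<tau>) *\<^sub>R x) \<le> 1" using e(2) mem_iff by blast
      moreover have "(1 + \<tau>) * \<gamma> x \<le> \<gamma> ((1 + \<tau>) *\<^sub>R x)"
        using \<sigma>(2)[OF \<sigma>(1)[of x], of "(1 + \<tau>) *\<^sub>R x"] by (simp add: \<gamma>_def)
      moreover have "\<gamma> x < (1 + \<tau>) * \<gamma> x" using pos[OF False] \<tau> by (simp add: distrib_right)
      ultimately show ?thesis by linarith
    qed (simp add: \<gamma>_def)
  qed
  have frontier: "y \<in> frontier K \<longleftrightarrow> \<gamma> (y - c) = 1" for y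
    using mem_iff[of "y - c"] interior[of "y - c"] Kcl by (auto simp: frontier_def)
  show ?thesis
    unfolding C1_boundary_def C1_hypersurface_def
  proof (intro conjI int ballI)
    fix p assume "p \<in> frontier K"
    then have "p \<in> - {c}" using c by (auto simp: frontier_def)
    moreover have "continuous_on (- {c}) (\<lambda>y. \<sigma> (y - c))"
      by (intro continuous_at_imp_continuous_on ballI isCont_o2[of _ "\<lambda>y. y - c" \<sigma>] cont continuous_intros) auto
    moreover have "\<sigma> (x - c) \<noteq> 0" if "x \<in> - {c}" for x using that pos[of "x - c"] by (auto simp: \<gamma>_def)
    moreover have "frontier K \<inter> - {c} = {x \<in> - {c}. \<gamma> (x - c) - 1 = 0}" by (auto simp: frontier)
    moreover have "GDERIV (\<lambda>x. \<gamma> (x - c) - 1) x :> \<sigma> (x - c)" if "x \<in> - {c}" for x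
    proof -
      have "GDERIV \<gamma> (x - c) :> \<sigma> (x - c)"
        unfolding \<gamma>_def using that by (intro GDERIV_maximiser[OF \<sigma>] cont) auto
      then have "(\<gamma> has_derivative (\<lambda>h. h \<bullet> \<sigma> (x - c))) (at (x - c))" by (simp add: gderiv_def)
      moreover have "((\<lambda>x. x - c) has_derivative (\<lambda>h. h)) (at x)" by (auto intro!: derivative_eq_intros)
      ultimately have "((\<lambda>x. \<gamma> (x - c)) has_derivative (\<lambda>h. h \<bullet> \<sigma> (x - c))) (at x)"
        using has_derivative_compose by fastforce
      then show ?thesis unfolding gderiv_def by (auto intro!: derivative_eq_intros)
    qed
    ultimately show "\<exists>U g g'. open U \<and> p \<in> U \<and> (\<forall>x\<in>U. GDERIV g x :> g' x) \<and> continuous_on U g' \<and>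
        (\<forall>x\<in>U. g' x \<noteq> 0) \<and> frontier K \<inter> U = {x \<in> U. g x = 0}"
      by (intro exI[of _ "- {c}"] exI[of _ "\<lambda>x. \<gamma> (x - c) - 1"] exI[of _ "\<lambda>x. \<sigma> (x - c)"] conjI) auto
  qed
qed

section \<open>Smooth strictly convex neighbourhoods\<close>

lemma norm_midpoint_parallelogram:
  fixes s s' :: "'b::real_inner"
  shows "(norm (midpoint s s'))\<^sup>2 = ((norm s)\<^sup>2 + (norm s')\<^sup>2) / 2 - (norm (s - s'))\<^sup>2 / 4"
  unfolding midpoint_def power2_norm_eq_inner
  by (simp add: inner_add_left inner_add_right inner_diff_left inner_diff_right inner_commute field_simps)

text \<open>Produces the target body of the perturbation: the margin \<open>r\<close> leaves room
  for the Birkhoff averages, while the closeness \<open>\<epsilon>\<close> to \<open>R\<close>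
  limits the size of the perturbation.\<close>

lemma regular_neighbourhood:
  fixes R :: "'b::euclidean_space set"
  assumes R: "compact R" "convex R" "R \<noteq> {}" and \<epsilon>: "\<epsilon> > 0"
  obtains K r where "compact K" "convex K" "r > 0" "\<And>\<epsilon>. \<epsilon> > 0 \<Longrightarrow> almost_regular \<epsilon> K"
    "\<And>z. z \<in> R \<Longrightarrow> ball z r \<subseteq> K" "\<And>p. p \<in> K \<Longrightarrow> \<exists>z\<in>R. dist p z < \<epsilon>"
proof -
  have Rcl: "closed R" using R by (simp add: compact_imp_closed)
  \<comment> \<open>Forming the ball hull costs at most \<open>r\<close> and adding the ball another
    \<open>r\<close>, so \<open>2 * r < \<epsilon>\<close> is what is needed.\<close>
  define r where "r = \<epsilon> / 3"
  have r: "r > 0" using \<epsilon> by (simp add: r_def)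
  define D where "D = diameter R"
  have D: "dist x y \<le> D" if "x \<in> R" "y \<in> R" for x y
    using diameter_bounded_bound[OF compact_imp_bounded[OF R(1)]] that by (simp add: D_def)
  have D0: "D \<ge> 0" unfolding D_def using compact_imp_bounded[OF R(1)] by (rule diameter_ge_0)
  \<comment> \<open>The bound \<open>\<rho> \<ge> D\<close> lets a ball centred in \<open>R\<close>
    cover \<open>R\<close>, and the term \<open>D\<^sup>2 / r\<close> ensures
    \<open>D\<^sup>2 + (\<rho> - r)\<^sup>2 \<le> \<rho>\<^sup>2\<close> for the separating balls
    below.\<close>
  define \<rho> where "\<rho> = D + r + D\<^sup>2 / r"
  have \<rho>: "\<rho> \<ge> D" "\<rho> \<ge> r" "\<rho> > 0" using D0 r by (auto simp: \<rho>_def add_nonneg_pos add_pos_nonneg)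
  \<comment> \<open>\<open>S\<close> is the hull of \<open>R\<close> by balls of radius \<open>\<rho>\<close>, hence strictly convex; adding a ball of
    radius \<open>r\<close> makes it smooth and keeps strict convexity.\<close>
  define S where "S = (\<Inter>c\<in>{c. R \<subseteq> cball c \<rho>}. cball c \<rho>)"
  have RS: "R \<subseteq> S" by (auto simp: S_def)
  obtain x0 where x0: "x0 \<in> R" using R by blast
  have x0R: "R \<subseteq> cball x0 \<rho>" using D[OF x0] \<rho>(1) by fastforce
  have Sconv: "convex S" unfolding S_def by (intro convex_INT convex_cball)
  have "closed S" unfolding S_def by (intro closed_INT ballI closed_cball)
  moreover have "S \<subseteq> cball x0 \<rho>" using x0R by (auto simp: S_def)
  ultimately have Scomp: "compact S" using bounded_subset[OF bounded_cball] compact_eq_bounded_closed by blast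
  have Sr: "dist x (closest_point R x) \<le> r" if x: "x \<in> S" for x
  proof (rule ccontr)
    define p where "p = closest_point R x"
    assume "\<not> dist x (closest_point R x) \<le> r"
    then have far: "norm (x - p) > r" by (simp add: dist_norm p_def)
    have pR: "p \<in> R" unfolding p_def by (rule closest_point_in_set[OF Rcl R(3)])
    define u where "u = (x - p) /\<^sub>R norm (x - p)"
    have "x \<noteq> p" using far r by auto
    then have u: "norm u = 1" "x - p = norm (x - p) *\<^sub>R u" by (auto simp: u_def)
    \<comment> \<open>The ball of radius \<open>\<rho>\<close> around this centre reaches exactly
      \<open>r\<close> beyond \<open>p\<close> in direction \<open>u\<close>. It still contains
      \<open>R\<close> but excludes \<open>x\<close>.\<close>
    define c where "c = p - (\<rho> - r) *\<^sub>R u"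
    have "R \<subseteq> cball c \<rho>"
    proof
      fix k assume k: "k \<in> R"
      have "(x - p) \<bullet> (k - p) \<le> 0" unfolding p_def by (rule closest_point_dot[OF R(2) Rcl k])
      then have "u \<bullet> (k - p) \<le> 0" using far r by (simp add: u_def mult_nonneg_nonpos)
      then have dot: "(\<rho> - r) * (u \<bullet> (k - p)) \<le> 0" using \<rho>(2) by (simp add: mult_nonneg_nonpos)
      have kc: "k - c = (k - p) + (\<rho> - r) *\<^sub>R u" by (simp add: c_def)
      have "(norm (k - c))\<^sup>2 = (norm (k - p))\<^sup>2 + 2 * ((\<rho> - r) * (u \<bullet> (k - p))) + (\<rho> - r)\<^sup>2 * (norm u)\<^sup>2"
        unfolding kc power2_norm_eq_inner
        by (simp only: inner_add_left inner_add_right inner_commute[of "k - p" u] inner_scaleR_left inner_scaleR_right power2_eq_square)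
           (simp add: algebra_simps)
      also have "\<dots> \<le> D\<^sup>2 + (\<rho> - r)\<^sup>2"
        using dot D[OF k pR] power_mono[of "norm (k - p)" D 2] by (simp add: u(1) dist_norm)
      also have "\<dots> = \<rho>\<^sup>2 - (2 * \<rho> * r - r\<^sup>2 - D\<^sup>2)" by (simp add: power2_diff)
      also have "2 * \<rho> * r - r\<^sup>2 - D\<^sup>2 = 2 * D * r + r\<^sup>2 + D\<^sup>2"
        using r by (simp add: \<rho>_def field_simps power2_eq_square)
      also have "\<rho>\<^sup>2 - (2 * D * r + r\<^sup>2 + D\<^sup>2) \<le> \<rho>\<^sup>2"
      proof -
        have "0 \<le> 2 * D * r + r\<^sup>2 + D\<^sup>2" using D0 r by (intro add_nonneg_nonneg) auto
        then show ?thesis by linarith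
      qed
      finally have "norm (k - c) \<le> \<rho>" using \<rho>(3) by (simp add: power2_le_iff_abs_le)
      then show "k \<in> cball c \<rho>" by (simp add: dist_norm norm_minus_commute)
    qed
    then have "dist c x \<le> \<rho>" using x by (auto simp: S_def)
    moreover have "x - c = (norm (x - p) + (\<rho> - r)) *\<^sub>R u" using u(2) by (simp add: c_def scaleR_add_left scaleR_diff_left algebra_simps)
    then have "norm (x - c) = norm (x - p) + (\<rho> - r)" using \<rho>(2) u(1) by simp
    then have "dist c x = norm (x - p) + (\<rho> - r)" by (simp add: dist_norm norm_minus_commute)
    ultimately show False using far by simp
  qed
  define K where "K = {s + u | s u. s \<in> S \<and> u \<in> cball 0 r}"
  have Kcomp: "compact K" unfolding K_def by (rule compact_sums[OF Scomp compact_cball])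
  have "K = (\<Union>s\<in>S. \<Union>u\<in>cball 0 r. {s + u})" unfolding K_def by blast
  then have Kconv: "convex K" using convex_sums[OF Sconv convex_cball] by simp
  have K_cball: "cball s r \<subseteq> K" if "s \<in> S" for s
  proof
    fix x assume "x \<in> cball s r"
    then have "x = s + (x - s)" "x - s \<in> cball 0 r" by (auto simp: dist_norm norm_minus_commute)
    then show "x \<in> K" unfolding K_def using that by blast
  qed
  \<comment> \<open>Maximality of \<open>v\<close> forces \<open>v \<bullet> u \<ge> r\<close>, the
    equality case of Cauchy-Schwarz for \<open>norm u \<le> r\<close>. Hence a boundary point
    determines its normal through its ball component.\<close>
  have normal: "u = r *\<^sub>R v" if N: "(s + u, v) \<in> outer_normals K" "s \<in> S" "norm u \<le> r" for s u v
  proof -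
    have v: "norm v = 1" and max: "\<And>k. k \<in> K \<Longrightarrow> v \<bullet> k \<le> v \<bullet> (s + u)" using N(1) by (auto simp: outer_normals_def)
    have "s + r *\<^sub>R v \<in> K" by (rule subsetD[OF K_cball[OF N(2)]]) (use v r in \<open>simp add: dist_norm\<close>)
    from max[OF this] have "r * (norm v)\<^sup>2 \<le> v \<bullet> u" by (simp add: inner_add_right power2_norm_eq_inner)
    then have dot: "r \<le> v \<bullet> u" by (simp add: v)
    have "(norm (u - r *\<^sub>R v))\<^sup>2 = (norm u)\<^sup>2 - 2 * r * (v \<bullet> u) + r\<^sup>2 * (norm v)\<^sup>2"
      unfolding power2_norm_eq_inner
      by (simp only: inner_diff_left inner_diff_right inner_scaleR_left inner_scaleR_right inner_commute[of u v] power2_eq_square)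
         (simp add: algebra_simps)
    also have "\<dots> \<le> r\<^sup>2 - 2 * r * r + r\<^sup>2"
    proof -
      have "(norm u)\<^sup>2 \<le> r\<^sup>2" using N(3) by (intro power_mono) auto
      moreover have "2 * r * r \<le> 2 * r * (v \<bullet> u)" using r by (intro mult_left_mono dot) auto
      ultimately show ?thesis unfolding v by simp
    qed
    also have "\<dots> = 0" by (simp add: power2_eq_square)
    finally show ?thesis by simp
  qed
  have smooth: "v = v'" if "(y, v) \<in> outer_normals K" "(y, v') \<in> outer_normals K" for y v v'
  proof -
    have "y \<in> K" using that by (simp add: outer_normals_def)
    then obtain s u where su: "y = s + u" "s \<in> S" "norm u \<le> r" by (auto simp: K_def)
    have "u = r *\<^sub>R v" "u = r *\<^sub>R v'" using normal su that by auto
    then show ?thesis using r by simp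
  qed
  have rotund: "y = y'" if N: "(y, v) \<in> outer_normals K" "(y', v) \<in> outer_normals K" for y y' v
  proof (rule ccontr)
    assume "y \<noteq> y'"
    have "y \<in> K" "y' \<in> K" and v: "norm v = 1" using N by (auto simp: outer_normals_def)
    then obtain s u s' u' where su: "y = s + u" "s \<in> S" "norm u \<le> r" "y' = s' + u'" "s' \<in> S" "norm u' \<le> r"
      by (auto simp: K_def)
    have u: "u = r *\<^sub>R v" "u' = r *\<^sub>R v" using normal[of s u v] normal[of s' u' v] su N by auto
    have max: "v \<bullet> t \<le> v \<bullet> s" "v \<bullet> t \<le> v \<bullet> s'" if "t \<in> S" for t
    proof -
      have "t + r *\<^sub>R v \<in> K" by (rule subsetD[OF K_cball[OF that]]) (use v r in \<open>simp add: dist_norm\<close>)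
      then have "v \<bullet> (t + r *\<^sub>R v) \<le> v \<bullet> y" "v \<bullet> (t + r *\<^sub>R v) \<le> v \<bullet> y'" using N by (auto simp: outer_normals_def)
      then show "v \<bullet> t \<le> v \<bullet> s" "v \<bullet> t \<le> v \<bullet> s'" by (auto simp: su u inner_add_right)
    qed
    have "s \<noteq> s'" using \<open>y \<noteq> y'\<close> su u by auto
    \<comment> \<open>By the parallelogram law the midpoint of \<open>s\<close> and
      \<open>s'\<close> gains \<open>q\<close> in squared distance in every ball defining
      \<open>S\<close>, independently of its centre. It can therefore be pushed along
      \<open>v\<close> without leaving \<open>S\<close>, against maximality.\<close>
    define q where "q = (norm (s - s'))\<^sup>2 / 4"
    have q: "q > 0" using \<open>s \<noteq> s'\<close> by (simp add: q_def)
    \<comment> \<open>The push increases the squared distance to a centre by at most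
      \<open>\<tau> * (2 * \<rho> + \<tau>)\<close>; with \<open>\<tau> \<le> 1\<close> this choice
      keeps it within \<open>q\<close>.\<close>
    define \<tau> where "\<tau> = min 1 (q / (2 * \<rho> + 1))"
    have \<tau>: "\<tau> > 0" "\<tau> \<le> 1" using q \<rho> by (auto simp: \<tau>_def)
    have "\<tau> * (2 * \<rho> + 1) \<le> q / (2 * \<rho> + 1) * (2 * \<rho> + 1)" using \<rho> by (intro mult_right_mono) (auto simp: \<tau>_def)
    then have \<tau>q: "\<tau> * (2 * \<rho> + 1) \<le> q" using \<rho> by simp
    define m where "m = midpoint s s'"
    have "m + \<tau> *\<^sub>R v \<in> S" unfolding S_def
    proof clarify
      fix c assume "R \<subseteq> cball c \<rho>"
      then have sc: "norm (s - c) \<le> \<rho>" "norm (s' - c) \<le> \<rho>" using su by (auto simp: S_def dist_norm norm_minus_commute)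
      have "m - c = midpoint (s - c) (s' - c)" by (simp add: m_def midpoint_def algebra_simps flip: scaleR_2)
      then have "(norm (m - c))\<^sup>2 = ((norm (s - c))\<^sup>2 + (norm (s' - c))\<^sup>2) / 2 - q"
        using norm_midpoint_parallelogram[of "s - c" "s' - c"] by (simp add: q_def)
      also have "\<dots> \<le> \<rho>\<^sup>2 - q" using power_mono[OF sc(1), of 2] power_mono[OF sc(2), of 2] by simp
      finally have mc: "(norm (m - c))\<^sup>2 \<le> \<rho>\<^sup>2 - q" .
      then have "(norm (m - c))\<^sup>2 \<le> \<rho>\<^sup>2" using q by simp
      then have mc': "norm (m - c) \<le> \<rho>" using \<rho>(3) by (simp add: power2_le_iff_abs_le)
      have "norm (m + \<tau> *\<^sub>R v - c) \<le> norm (m - c) + \<tau>"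
        using norm_triangle_ineq[of "m - c" "\<tau> *\<^sub>R v"] v \<tau> by (simp add: algebra_simps)
      then have "(norm (m + \<tau> *\<^sub>R v - c))\<^sup>2 \<le> (norm (m - c) + \<tau>)\<^sup>2" by (intro power_mono) auto
      also have "\<dots> = (norm (m - c))\<^sup>2 + \<tau> * (2 * norm (m - c) + \<tau>)" by (simp add: power2_eq_square algebra_simps)
      also have "\<tau> * (2 * norm (m - c) + \<tau>) \<le> \<tau> * (2 * \<rho> + 1)" using \<tau> mc' by (intro mult_left_mono) auto
      finally have "(norm (m + \<tau> *\<^sub>R v - c))\<^sup>2 \<le> \<rho>\<^sup>2" using mc \<tau>q by linarith
      then have "norm (m + \<tau> *\<^sub>R v - c) \<le> \<rho>" using \<rho>(3) by (simp add: power2_le_iff_abs_le)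
      then show "m + \<tau> *\<^sub>R v \<in> cball c \<rho>" by (simp add: dist_norm norm_minus_commute)
    qed
    from max(1)[OF this] max(2)[OF this] have "v \<bullet> m + \<tau> * (norm v)\<^sup>2 \<le> (v \<bullet> s + v \<bullet> s') / 2"
      by (simp add: inner_add_right power2_norm_eq_inner)
    moreover have "v \<bullet> m = (v \<bullet> s + v \<bullet> s') / 2" by (simp add: m_def midpoint_def inner_add_right)
    moreover have "\<tau> * (norm v)\<^sup>2 = \<tau>" by (simp add: v)
    ultimately show False using \<tau>(1) by linarith
  qed
  show thesis
  proof (rule that[OF Kcomp Kconv r])
    show "almost_regular e K" if "e > 0" for e using that smooth rotund unfolding almost_regular_def by (metis dist_self)
    show "ball z r \<subseteq> K" if "z \<in> R" for z using K_cball that RS ball_subset_cball by blast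
    fix p assume "p \<in> K"
    then obtain s u where su: "p = s + u" "s \<in> S" "norm u \<le> r" by (auto simp: K_def)
    have "dist p (closest_point R s) \<le> dist p s + dist s (closest_point R s)" by (rule dist_triangle)
    also have "\<dots> \<le> r + r" using Sr[OF su(2)] su by (intro add_mono) (auto simp: dist_norm)
    also have "\<dots> < \<epsilon>" using \<epsilon> by (simp add: r_def)
    finally show "\<exists>z\<in>R. dist p z < \<epsilon>" using closest_point_in_set[OF Rcl R(3)] by blast
  qed
qed

section \<open>Genericity\<close>

lemma (in compact_dynamics) dist_integral_le:
  fixes f h :: "'a \<Rightarrow> 'b::euclidean_space"
  assumes \<mu>: "\<mu> \<in> invariant_measures T" and c: "continuous_on UNIV f" "continuous_on UNIV h"
    and le: "\<And>x. dist (f x) (h x) \<le> e"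
  shows "dist (integral\<^sup>L \<mu> f) (integral\<^sup>L \<mu> h) \<le> e"
proof -
  have i: "integrable \<mu> f" "integrable \<mu> h" using integrable_invariant[OF \<mu>] c by auto
  have "(\<integral>x. f x - h x \<partial>\<mu>) \<in> cball 0 e"
    by (rule prob_space.integral_in_closed_convex[OF invariantD(1)[OF \<mu>]]) (use i le in \<open>auto simp: dist_norm norm_minus_commute\<close>)
  then show ?thesis using i by (simp add: dist_norm norm_minus_commute)
qed

lemma (in compact_dynamics) rotation_set_eq: "rotation_set T F = integrals (apply_bcontfun F)"
  by (simp add: rotation_set_def integrals_def)

text \<open>Integrating two uniformly close functions against the same measure shows that their
  rotation sets are Hausdorff close, so stability of almost regularity applies.\<close>

lemma (in compact_dynamics) open_almost_regular:
  "open {F :: 'a \<Rightarrow>\<^sub>C (real ^ 'n). almost_regular \<epsilon> (rotation_set T F)}"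
  unfolding open_dist
proof (intro ballI)
  fix F :: "'a \<Rightarrow>\<^sub>C (real ^ 'n)" assume "F \<in> {F. almost_regular \<epsilon> (rotation_set T F)}"
  then have "almost_regular \<epsilon> (integrals (apply_bcontfun F))" by (simp add: rotation_set_eq)
  then obtain \<delta> where \<delta>: "\<delta> > 0" and st: "\<And>L. \<lbrakk>\<And>y. y \<in> L \<Longrightarrow> \<exists>k\<in>integrals (apply_bcontfun F). dist y k < \<delta>;
      \<And>k. k \<in> integrals (apply_bcontfun F) \<Longrightarrow> \<exists>y\<in>L. dist k y < \<delta>\<rbrakk> \<Longrightarrow> almost_regular \<epsilon> L"
    using almost_regular_stable[OF compact_integrals[of "apply_bcontfun F"]] by (metis continuous_on_apply_bcontfun)
  have "almost_regular \<epsilon> (integrals (apply_bcontfun G))" if "dist G F < \<delta>" for G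
  proof (rule st)
    have d: "dist (integral\<^sup>L \<mu> G) (integral\<^sup>L \<mu> F) < \<delta>" if "\<mu> \<in> invariant_measures T" for \<mu>
      by (rule le_less_trans[OF dist_integral_le[OF that _ _ dist_bounded] \<open>dist G F < \<delta>\<close>]) auto
    show "\<exists>k\<in>integrals (apply_bcontfun F). dist y k < \<delta>" if "y \<in> integrals (apply_bcontfun G)" for y
      using that d by (auto simp: integrals_def)
    show "\<exists>y\<in>integrals (apply_bcontfun G). dist k y < \<delta>" if "k \<in> integrals (apply_bcontfun F)" for k
      using that d by (auto simp: integrals_def dist_commute)
  qed
  then show "\<exists>e>0. \<forall>G. dist G F < e \<longrightarrow> G \<in> {F. almost_regular \<epsilon> (rotation_set T F)}"
    using \<delta> by (auto simp: rotation_set_eq)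
qed

text \<open>Failure of unique ergodicity supplies a continuous \<open>g\<close> with different
  integrals for two invariant measures, the source of the labels that distinguish orbits in the
  perturbation.\<close>

lemma (in dense_periodic_dynamics) dense_almost_regular:
  assumes nue: "\<not> uniquely_ergodic T" and \<epsilon>: "\<epsilon> > 0"
  shows "closure {F :: 'a \<Rightarrow>\<^sub>C (real ^ 'n). almost_regular \<epsilon> (rotation_set T F)} = UNIV"
proof -
  obtain \<mu>\<^sub>1 \<mu>\<^sub>2 where \<mu>: "\<mu>\<^sub>1 \<in> invariant_measures T" "\<mu>\<^sub>2 \<in> invariant_measures T" "\<mu>\<^sub>1 \<noteq> \<mu>\<^sub>2"
    using nue invariant_measures_nonempty unfolding uniquely_ergodic_def by blast
  obtain g :: "'a \<Rightarrow> real" where g: "continuous_on UNIV g" "integral\<^sup>L \<mu>\<^sub>1 g \<noteq> integral\<^sup>L \<mu>\<^sub>2 g"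
    using measure_eqI_continuous_integrals[OF invariantD(1)[OF \<mu>(1)] invariantD(1)[OF \<mu>(2)]
        invariantD(2)[OF \<mu>(1)] invariantD(2)[OF \<mu>(2)]] \<mu>(3) by blast
  have "\<exists>G\<in>{F. almost_regular \<epsilon> (rotation_set T F)}. dist G F < e" if "e > 0" for F :: "'a \<Rightarrow>\<^sub>C (real ^ 'n)" and e
  proof -
    have Fc: "continuous_on UNIV (apply_bcontfun F)" by simp
    have e2: "e / 2 > 0" using that by simp
    obtain K r where K: "compact K" "convex K" and r: "r > 0" and reg: "\<And>\<epsilon>. \<epsilon> > 0 \<Longrightarrow> almost_regular \<epsilon> K"
      and inner: "\<And>z. z \<in> integrals (apply_bcontfun F) \<Longrightarrow> ball z r \<subseteq> K"
      and near: "\<And>p. p \<in> K \<Longrightarrow> \<exists>z\<in>integrals (apply_bcontfun F). dist p z < e / 2"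
      by (rule regular_neighbourhood[OF compact_integrals[OF Fc] convex_integrals[OF Fc] integrals_nonempty e2], rule that)
         assumption+
    obtain \<delta> where \<delta>: "\<delta> > 0" and st: "\<And>L. \<lbrakk>\<And>y. y \<in> L \<Longrightarrow> \<exists>k\<in>K. dist y k < \<delta>;
      \<And>k. k \<in> K \<Longrightarrow> \<exists>y\<in>L. dist k y < \<delta>\<rbrakk> \<Longrightarrow> almost_regular \<epsilon> L"
      by (rule almost_regular_stable[OF K(1) reg[OF \<epsilon>]], rule that) blast+
    obtain G where Gc: "continuous_on UNIV G" and GF: "\<And>x. dist (G x) (apply_bcontfun F x) \<le> e / 2"
      and GK: "integrals G \<subseteq> K" and KG: "\<And>p. p \<in> K \<Longrightarrow> \<exists>z\<in>integrals G. dist p z < \<delta>"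
      by (rule integrals_approximate_body[OF Fc g(1) \<mu>(1,2) g(2) K r inner near \<delta>], assumption, assumption, rule that)
         assumption+
    have "almost_regular \<epsilon> (integrals G)"
      by (rule st) (use GK KG \<delta> in force)+
    moreover have "dist (Bcontfun G) F \<le> e / 2"
      by (rule dist_bound) (use GF in \<open>simp add: apply_Bcontfun[OF Gc]\<close>)
    ultimately show ?thesis
      using that by (intro bexI[of _ "Bcontfun G"]) (auto simp: rotation_set_eq apply_Bcontfun[OF Gc])
  qed
  then show ?thesis by (auto simp: closure_approachable)
qed

theorem corollary1p2:
  fixes T :: "'a::metric_space \<Rightarrow> 'a"
  assumes "compact (UNIV :: 'a set)"
    and "continuous_on UNIV T"
    and "\<not> uniquely_ergodic T"
    and "weak_star_topology T closure_of periodic_measures T = invariant_measures T"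
  shows "\<exists>\<R> :: ('a \<Rightarrow>\<^sub>C (real ^ 'n)) set. residual \<R> \<and>
           (\<forall>F\<in>\<R>. strictly_convex (rotation_set T F) \<and> C1_boundary (rotation_set T F))"
proof -
  interpret dense_periodic_dynamics T by unfold_locales (use assms in auto)
  \<comment> \<open>Almost regularity is monotone in \<open>\<epsilon>\<close>, so these countably
    many thresholds capture all positive ones.\<close>
  define U where "U n = {F :: 'a \<Rightarrow>\<^sub>C (real ^ 'n). almost_regular (1 / real (Suc n)) (rotation_set T F)}" for n
  have "residual (\<Inter>(range U))"
    unfolding residual_def
  proof (intro exI conjI ballI)
    fix V assume "V \<in> range U"
    then obtain n where V: "V = U n" by blast
    show "open V" unfolding V U_def by (rule open_almost_regular)
    show "closure V = UNIV" unfolding V U_def by (rule dense_almost_regular[OF assms(3)]) simp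
  qed auto
  moreover have "strictly_convex (rotation_set T F) \<and> C1_boundary (rotation_set T F)" if F: "F \<in> \<Inter>(range U)" for F
  proof -
    have reg: "almost_regular \<epsilon> (rotation_set T F)" if "\<epsilon> > 0" for \<epsilon>
    proof -
      obtain n where n: "1 / real (Suc n) < \<epsilon>" using nat_approx_posE[OF \<open>\<epsilon> > 0\<close>] by blast
      have "almost_regular (1 / real (Suc n)) (rotation_set T F)" using F by (auto simp: U_def)
      then show ?thesis unfolding almost_regular_def using n by (meson less_trans)
    qed
    have K: "rotation_set T F \<noteq> {}" "compact (rotation_set T F)" "convex (rotation_set T F)"
      unfolding rotation_set_eq by (intro integrals_nonempty compact_integrals convex_integrals continuous_on_apply_bcontfun)+
    have "interior (rotation_set T F) \<noteq> {}"
      by (rule interior_nonempty_of_almost_regular[OF K(1,3) reg]) simp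
    with K reg show ?thesis using strictly_convexI C1_boundaryI by blast
  qed
  ultimately show ?thesis by blast
qed

end
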